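(* Let $W$ be a Gaussian white noise on $\mathbb R\times[0,1]^{\mathbb N}$ with intensity $\mathrm{Leb}_1\otimes P$ ($P$ the law of an i.i.d. uniform$[0,1]$ sequence), $W_l(dx,dy_1,\ldots,dy_l):=W(dx,dy_1,\ldots,dy_l,[0,1]^{\mathbb N})$, $\psi_0(x):=e^{-x}$, $\psi_l(x):=\frac{x^l}{l!}e^{-x}$. Define, for $u\in\mathbb R$, $$Z_1(u):=-\int_{\mathbb R\times[0,1]}\Big(\mathbf 1_{\{y\le \exp(-e^{-(x-u)})\}}-\exp(-e^{-(x-u)})\Big)W_1(dx,dy),$$ $$X_k(u):=\int_{\mathbb R\times[0,1]^{k+1}}\Big(\mathbf 1_{\{y_1\cdots y_{k+1}<\psi_0(e^{-(x-u)})<y_1\cdots y_k\}}-\psi_k(e^{-(x-u)})\Big)W_{k+1}(dx,dy_1,\ldots,dy_{k+1}),\quad k\in\mathbb N,$$ and $Z_l(u):=Z_1(u)-\sum_{k=1}^{l-1}X_k(u)$ for $l\in\mathbb N$. Then each $Z_l=(Z_l(u))_{u\in\mathbb R}$ is a centered stationary Gaussian process with $$\mathrm{Cov}(Z_l(u),Z_l(v))=\log(1+e^{-|u-v|})-\sum_{k=1}^{l-1}\frac{(2k-1)!\,e^{-|u-v|k}}{(k!)^2(1+e^{-|u-v|})^{2k}},\quad u,v\in\mathbb R,$$ and, for $l\in\mathbb N$, $n\in\mathbb N_0$, $u,v\in\mathbb R$, $$\mathbb E Z_l(u)Z_{l+n}(v)=\log(1+e^{-|u-v|})-\sum_{k=1}^{l-1}\frac{(2k-1)!\,e^{-|u-v|k}}{(k!)^2(1+e^{-|u-v|})^{2k}}+\sum_{r=0}^{n-1}\sum_{i=0}^{l-1}\Big(\frac{1}{l+r}\binom{l+r}{i}\big((1-e^{u-v})_+\big)^{l+r-i}e^{(u-v)i}-\frac{1}{l+r+i}\binom{l+r+i}{i}\frac{e^{(u-v)i}}{(1+e^{u-v})^{l+r+i}}\Big).$$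 Moreover, for each $l$, the process $Z_l$ has a version whose sample paths are Hölder continuous with exponent $\alpha$ for each $\alpha\in(0,1/2)$.
   Context: A Gaussian white noise $W$ on a measure space with intensity $\mu$ assigns to each set $A$ of finite $\mu$-measure a centered normal random variable $W(A)$ with $\mathbb E W(A)W(B)=\mu(A\cap B)$; integrals of deterministic square-integrable functions against $W$ are Wiener integrals. $\mathrm{Leb}_1$ is Lebesgue measure on $\mathbb R$. $x_+=\max(x,0)$.
   Formalization: Hölder continuity of the sample paths is stated locally, i.e. on every compact interval; a global Hölder bound on all of ℝ fails almost surely, since the increments of this non-degenerate stationary Gaussian process over unit intervals are unbounded. *)

theory Defs
  imports "HOL-Probability.Probability"
begin

definition centered_normal :: "'w measure \<Rightarrow> ('w \<Rightarrow> real) \<Rightarrow> real \<Rightarrow> bool" where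
  "centered_normal M X s \<longleftrightarrow> X \<in> borel_measurable M \<and>
     ((s = 0 \<and> (AE \<omega> in M. X \<omega> = 0)) \<or>
      (s > 0 \<and> distributed M lborel X (\<lambda>x. ennreal (normal_density 0 (sqrt s) x))))"

definition centered_gaussian_family :: "'w measure \<Rightarrow> 'i set \<Rightarrow> ('i \<Rightarrow> 'w \<Rightarrow> real) \<Rightarrow> bool" where
  "centered_gaussian_family M S X \<longleftrightarrow>
     (\<forall>i\<in>S. X i \<in> borel_measurable M) \<and>
     (\<forall>J c. finite J \<and> J \<subseteq> S \<longrightarrow> (\<exists>s. centered_normal M (\<lambda>\<omega>. \<Sum>i\<in>J. c i * X i \<omega>) s))"

definition stationary_process :: "'w measure \<Rightarrow> (real \<Rightarrow> 'w \<Rightarrow> real) \<Rightarrow> bool" where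
  "stationary_process M Z \<longleftrightarrow>
     (\<forall>J h. finite J \<longrightarrow>
        distr M (PiM J (\<lambda>_. borel)) (\<lambda>\<omega>. \<lambda>i\<in>J. Z (i + h) \<omega>) =
        distr M (PiM J (\<lambda>_. borel)) (\<lambda>\<omega>. \<lambda>i\<in>J. Z i \<omega>))"

definition finite_measure_sets :: "'x measure \<Rightarrow> 'x set set" where
  "finite_measure_sets \<mu> = {A \<in> sets \<mu>. emeasure \<mu> A < \<infinity>}"

definition gaussian_white_noise :: "'w measure \<Rightarrow> 'x measure \<Rightarrow> ('x set \<Rightarrow> 'w \<Rightarrow> real) \<Rightarrow> bool" where
  "gaussian_white_noise M \<mu> W \<longleftrightarrow>
     centered_gaussian_family M (finite_measure_sets \<mu>) W \<and>
     (\<forall>A\<in>finite_measure_sets \<mu>. \<forall>B\<in>finite_measure_sets \<mu>.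
        integral\<^sup>L M (\<lambda>\<omega>. W A \<omega> * W B \<omega>) = measure \<mu> (A \<inter> B))"

definition square_integrable :: "'x measure \<Rightarrow> ('x \<Rightarrow> real) \<Rightarrow> bool" where
  "square_integrable \<mu> f \<longleftrightarrow> f \<in> borel_measurable \<mu> \<and> integrable \<mu> (\<lambda>x. (f x)^2)"

text \<open>I is the Wiener integral w.r.t. W: linear (a.s.), extends W on indicators (a.s.),
  and isometric from L2(\<mu>) to L2(M).  These properties determine I f a.s.\<close>
definition wiener_integral :: "'w measure \<Rightarrow> 'x measure \<Rightarrow> ('x set \<Rightarrow> 'w \<Rightarrow> real)
    \<Rightarrow> (('x \<Rightarrow> real) \<Rightarrow> 'w \<Rightarrow> real) \<Rightarrow> bool" where
  "wiener_integral M \<mu> W I \<longleftrightarrow>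
     (\<forall>A\<in>finite_measure_sets \<mu>. AE \<omega> in M. I (indicator A) \<omega> = W A \<omega>) \<and>
     (\<forall>f g a b. square_integrable \<mu> f \<longrightarrow> square_integrable \<mu> g \<longrightarrow>
        (AE \<omega> in M. I (\<lambda>x. a * f x + b * g x) \<omega> = a * I f \<omega> + b * I g \<omega>)) \<and>
     (\<forall>f. square_integrable \<mu> f \<longrightarrow>
        I f \<in> borel_measurable M \<and> integrable M (\<lambda>\<omega>. (I f \<omega>)^2) \<and>
        integral\<^sup>L M (\<lambda>\<omega>. (I f \<omega>)^2) = integral\<^sup>L \<mu> (\<lambda>x. (f x)^2))"

text \<open>P: law of an i.i.d. uniform[0,1] sequence (coordinates y 0, y 1, ... = y_1, y_2, ...).\<close>
definition P_unif :: "(nat \<Rightarrow> real) measure" where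
  "P_unif = PiM UNIV (\<lambda>_. uniform_measure lborel {0..1})"

definition intensity :: "(real \<times> (nat \<Rightarrow> real)) measure" where
  "intensity = lborel \<Otimes>\<^sub>M P_unif"

definition psi :: "nat \<Rightarrow> real \<Rightarrow> real" where
  "psi l x = x ^ l / fact l * exp (- x)"

text \<open>Integrals against W_l are integrals against W of functions depending only on
  (x, y_1, ..., y_l), i.e. on x and the coordinates y 0, ..., y (l-1).\<close>
definition Z1 :: "(((real \<times> (nat \<Rightarrow> real)) \<Rightarrow> real) \<Rightarrow> 'w \<Rightarrow> real) \<Rightarrow> real \<Rightarrow> 'w \<Rightarrow> real" where
  "Z1 I u = (\<lambda>\<omega>. - I (\<lambda>(x, y). (if y 0 \<le> exp (- exp (- (x - u))) then 1 else 0)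
                               - exp (- exp (- (x - u)))) \<omega>)"

definition Xk :: "(((real \<times> (nat \<Rightarrow> real)) \<Rightarrow> real) \<Rightarrow> 'w \<Rightarrow> real) \<Rightarrow> nat \<Rightarrow> real \<Rightarrow> 'w \<Rightarrow> real" where
  "Xk I k u = I (\<lambda>(x, y).
      (if (\<Prod>i<k+1. y i) < psi 0 (exp (- (x - u))) \<and> psi 0 (exp (- (x - u))) < (\<Prod>i<k. y i)
       then 1 else 0) - psi k (exp (- (x - u))))"

definition Zl :: "(((real \<times> (nat \<Rightarrow> real)) \<Rightarrow> real) \<Rightarrow> 'w \<Rightarrow> real) \<Rightarrow> nat \<Rightarrow> real \<Rightarrow> 'w \<Rightarrow> real" where
  "Zl I l u = (\<lambda>\<omega>. Z1 I u \<omega> - (\<Sum>k\<in>{1..<l}. Xk I k u \<omega>))"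

definition cov_Z :: "nat \<Rightarrow> real \<Rightarrow> real" where
  "cov_Z l t = ln (1 + exp (- \<bar>t\<bar>))
     - (\<Sum>k\<in>{1..<l}. fact (2*k - 1) * exp (- \<bar>t\<bar> * k) / ((fact k)^2 * (1 + exp (- \<bar>t\<bar>)) ^ (2*k)))"

definition cross_cov_Z :: "nat \<Rightarrow> nat \<Rightarrow> real \<Rightarrow> real \<Rightarrow> real" where
  "cross_cov_Z l n u v = cov_Z l (u - v) +
     (\<Sum>r<n. \<Sum>i<l.
        1 / real (l + r) * real ((l + r) choose i) * (max 0 (1 - exp (u - v))) ^ (l + r - i) * exp ((u - v) * i)
      - 1 / real (l + r + i) * real ((l + r + i) choose i) * exp ((u - v) * i) / (1 + exp (u - v)) ^ (l + r + i))"

definition locally_holder :: "(real \<Rightarrow> real) \<Rightarrow> real \<Rightarrow> bool" where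
  "locally_holder f \<alpha> \<longleftrightarrow>
     (\<forall>a b. \<exists>C. \<forall>u\<in>{a..b}. \<forall>v\<in>{a..b}. \<bar>f u - f v\<bar> \<le> C * \<bar>u - v\<bar> powr \<alpha>)"

end

theory Submission
  imports Defs
begin

text \<open>
  Put \<open>s = exp (u - x)\<close> and let \<open>N\<close> be the Poisson process whose arrival times are
  \<open>- ln (y\<^sub>1 \<cdots> y\<^sub>k)\<close>.  The integrand of \<open>X\<^sub>k(u)\<close> is the centered indicator of the event
  \<open>N(s) = k\<close>, and \<open>Z\<^sub>1 = - X\<^sub>0\<close> almost surely, so that
  \<open>Z\<^sub>l = - (X\<^sub>0 + \<cdots> + X\<^sub>l\<^sub>-\<^sub>1)\<close>.  By the Wiener isometry the covariance of \<open>X\<^sub>i(u)\<close> and \<open>X\<^sub>j(v)\<close>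
  is the integral over \<open>x\<close> of a covariance of Poisson events.  The increments of \<open>N\<close> are independent,
  so it reduces to integrals of products of two Poisson weights, which are binomial probabilities
  divided by \<open>i + j\<close> or \<open>j\<close> (and a Frullani integral for \<open>i = j = 0\<close>).  Summing over \<open>i, j < l\<close>
  telescopes in \<open>l\<close>, because one of the two ways in which a sequence of Bernoulli trials can be
  decided has to occur.
  Gaussian laws are determined by their covariances, which gives stationarity, and the increments
  satisfy \<open>E (Z\<^sub>l(u) - Z\<^sub>l(v))\<^sup>2 \<le> 2 \<bar>u - v\<bar>\<close>, so all their even moments are controlled and the
  Kolmogorov-Chentsov argument yields the Hoelder continuous version.
\<close>

section \<open>Square integrable functions\<close>

lemma square_integrable_mult:
  assumes "square_integrable \<mu> f" "square_integrable \<mu> g"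
  shows "integrable \<mu> (\<lambda>x. f x * g x)"
proof (rule Bochner_Integration.integrable_bound)
  show "integrable \<mu> (\<lambda>x. (f x)\<^sup>2 + (g x)\<^sup>2)" "(\<lambda>x. f x * g x) \<in> borel_measurable \<mu>"
    using assms by (auto simp: square_integrable_def)
  have "\<bar>a * b\<bar> \<le> a\<^sup>2 + b\<^sup>2" for a b :: real
  proof -
    have "0 \<le> \<bar>a\<bar> * \<bar>b\<bar>" by simp
    then show ?thesis
      using sum_squares_bound[of "\<bar>a\<bar>" "\<bar>b\<bar>"] unfolding abs_mult power2_abs by linarith
  qed
  then show "AE x in \<mu>. norm (f x * g x) \<le> norm ((f x)\<^sup>2 + (g x)\<^sup>2)"
    by auto
qed

lemma square_integrable_lincomb:
  assumes "square_integrable \<mu> f" "square_integrable \<mu> g"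
  shows "square_integrable \<mu> (\<lambda>x. a * f x + b * g x)"
proof -
  have "integrable \<mu> (\<lambda>x. a\<^sup>2 * (f x)\<^sup>2 + b\<^sup>2 * (g x)\<^sup>2 + 2 * a * b * (f x * g x))"
    using assms square_integrable_mult[OF assms] by (auto simp: square_integrable_def)
  then show ?thesis using assms
    by (auto simp: square_integrable_def power2_eq_square algebra_simps)
qed

lemma square_integrable_diff:
  assumes "square_integrable \<mu> f" "square_integrable \<mu> g"
  shows "square_integrable \<mu> (\<lambda>x. f x - g x)"
  using square_integrable_lincomb[OF assms, of 1 "-1"] by simp

lemma square_integrable_zero [simp]: "square_integrable \<mu> (\<lambda>x. 0)"
  by (simp add: square_integrable_def)

lemma square_integrable_sum:
  assumes "\<And>i. i \<in> J \<Longrightarrow> square_integrable \<mu> (f i)"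
  shows "square_integrable \<mu> (\<lambda>x. \<Sum>i\<in>J. c i * f i x)"
  using assms
proof (induction J rule: infinite_finite_induct)
  case (insert i J)
  then show ?case
    using square_integrable_lincomb[of \<mu> "f i" "\<lambda>x. \<Sum>i\<in>J. c i * f i x" "c i" 1] by simp
qed auto

lemma square_integrable_cong_AE:
  assumes "square_integrable \<mu> f" "AE x in \<mu>. f x = g x" and [measurable]: "g \<in> borel_measurable \<mu>"
  shows "square_integrable \<mu> g"
proof -
  have [measurable]: "f \<in> borel_measurable \<mu>" and "integrable \<mu> (\<lambda>x. (f x)\<^sup>2)"
    using assms by (auto simp: square_integrable_def)
  moreover have "AE x in \<mu>. (f x)\<^sup>2 = (g x)\<^sup>2"
    using assms(2) by eventually_elim simp
  ultimately have "integrable \<mu> (\<lambda>x. (g x)\<^sup>2)"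
    by (subst integrable_cong_AE[symmetric]) auto
  then show ?thesis by (simp add: square_integrable_def)
qed

lemma square_integrable_indicator:
  assumes "A \<in> finite_measure_sets \<mu>"
  shows "square_integrable \<mu> (indicator A)"
  using assms
  by (auto simp: square_integrable_def finite_measure_sets_def power2_eq_square
      indicator_inter_arith[symmetric] intro!: integrable_real_indicator)

lemma integral_sum_mult_sum:
  assumes "\<And>i. i \<in> J \<Longrightarrow> square_integrable \<mu> (f i)" "\<And>k. k \<in> K \<Longrightarrow> square_integrable \<mu> (g k)"
  shows "(\<integral>x. (\<Sum>i\<in>J. a i * f i x) * (\<Sum>k\<in>K. b k * g k x) \<partial>\<mu>) =
    (\<Sum>i\<in>J. \<Sum>k\<in>K. a i * b k * (\<integral>x. f i x * g k x \<partial>\<mu>))"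
proof -
  have summand_integrable: "integrable \<mu> (\<lambda>x. a i * b k * (f i x * g k x))" if "i \<in> J" "k \<in> K" for i k
    using assms that by (intro integrable_mult_right square_integrable_mult)
  have "(\<integral>x. (\<Sum>i\<in>J. a i * f i x) * (\<Sum>k\<in>K. b k * g k x) \<partial>\<mu>) =
      (\<integral>x. (\<Sum>i\<in>J. \<Sum>k\<in>K. a i * b k * (f i x * g k x)) \<partial>\<mu>)"
    by (simp add: sum_product mult_ac)
  also have "\<dots> = (\<Sum>i\<in>J. \<integral>x. (\<Sum>k\<in>K. a i * b k * (f i x * g k x)) \<partial>\<mu>)"
    by (intro Bochner_Integration.integral_sum Bochner_Integration.integrable_sum summand_integrable)
  also have "\<dots> = (\<Sum>i\<in>J. \<Sum>k\<in>K. \<integral>x. a i * b k * (f i x * g k x) \<partial>\<mu>)"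
    by (intro sum.cong refl Bochner_Integration.integral_sum summand_integrable)
  finally show ?thesis by simp
qed

lemma integral_diff_square:
  assumes "square_integrable \<mu> f" "square_integrable \<mu> g"
  shows "(\<integral>x. (f x - g x)\<^sup>2 \<partial>\<mu>) =
    (\<integral>x. f x * f x \<partial>\<mu>) - 2 * (\<integral>x. f x * g x \<partial>\<mu>) + (\<integral>x. g x * g x \<partial>\<mu>)"
proof -
  have "(f x - g x)\<^sup>2 = f x * f x - 2 * (f x * g x) + g x * g x" for x
    by (simp add: power2_eq_square algebra_simps)
  then show ?thesis
    using assms by (simp add: square_integrable_mult)
qed

lemma AE_eq_0_if_second_moment_0:
  fixes f :: "'x \<Rightarrow> real"
  assumes "integrable \<mu> (\<lambda>x. (f x)\<^sup>2)" "(\<integral>x. (f x)\<^sup>2 \<partial>\<mu>) = 0"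
  shows "AE x in \<mu>. f x = 0"
  using integral_nonneg_eq_0_iff_AE[OF assms(1)] assms(2) by simp

lemma level_set_in_finite_measure_sets:
  assumes "simple_function \<mu> F" "square_integrable \<mu> F" and "y \<noteq> 0"
  shows "F -` {y} \<inter> space \<mu> \<in> finite_measure_sets \<mu>"
proof -
  let ?A = "F -` {y} \<inter> space \<mu>"
  have meas: "?A \<in> sets \<mu>" using assms(1) by (rule simple_functionD)
  have "integrable \<mu> (\<lambda>x. (1 / y\<^sup>2) * (F x)\<^sup>2)"
    using assms(2) by (simp add: square_integrable_def)
  then have "integrable \<mu> (indicator ?A :: _ \<Rightarrow> real)"
    by (rule Bochner_Integration.integrable_bound) (use meas \<open>y \<noteq> 0\<close> in \<open>auto simp: indicator_def\<close>)
  then show ?thesis using meas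
    by (auto simp: finite_measure_sets_def integrable_indicator_iff)
qed

lemma simple_function_sum_level_sets:
  fixes F :: "'x \<Rightarrow> real"
  assumes simple: "simple_function \<mu> F" and "x \<in> space \<mu>"
  shows "F x = (\<Sum>y\<in>F ` space \<mu> - {0}. y * indicator (F -` {y} \<inter> space \<mu>) x)"
proof -
  have "F x = (\<Sum>y\<in>F ` space \<mu>. indicator (F -` {y} \<inter> space \<mu>) x *\<^sub>R y)"
    using assms by (rule simple_function_indicator_representation_banach)
  also have "\<dots> = (\<Sum>y\<in>F ` space \<mu> - {0}. indicator (F -` {y} \<inter> space \<mu>) x *\<^sub>R y)"
    using simple by (intro sum.mono_neutral_right) (auto simp: simple_function_def)
  also have "\<dots> = (\<Sum>y\<in>F ` space \<mu> - {0}. y * indicator (F -` {y} \<inter> space \<mu>) x)"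
    by (simp add: mult.commute)
  finally show ?thesis .
qed

lemma square_integrable_simple_approx:
  assumes f_sq: "square_integrable \<mu> f"
  obtains F where "\<And>n. simple_function \<mu> (F n)" "\<And>n. square_integrable \<mu> (F n)"
    "(\<lambda>n. \<integral>x. (F n x)\<^sup>2 \<partial>\<mu>) \<longlonglongrightarrow> (\<integral>x. (f x)\<^sup>2 \<partial>\<mu>)"
    "(\<lambda>n. \<integral>x. (F n x - f x)\<^sup>2 \<partial>\<mu>) \<longlonglongrightarrow> 0"
proof -
  have [measurable]: "f \<in> borel_measurable \<mu>" and f_sq_integrable: "integrable \<mu> (\<lambda>x. (f x)\<^sup>2)"
    using f_sq by (auto simp: square_integrable_def)
  obtain F where F_approx: "\<And>n. simple_function \<mu> (F n)" "\<And>x. x \<in> space \<mu> \<Longrightarrow> (\<lambda>n. F n x) \<longlonglongrightarrow> f x"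
    "\<And>n x. x \<in> space \<mu> \<Longrightarrow> \<bar>F n x\<bar> \<le> 2 * \<bar>f x\<bar>"
    using borel_measurable_implies_sequence_metric[of f \<mu> 0] by (simp add: dist_real_def) metis
  have [measurable]: "F n \<in> borel_measurable \<mu>" for n
    using F_approx(1) by (rule borel_measurable_simple_function)
  have bound: "(F n x)\<^sup>2 \<le> 4 * (f x)\<^sup>2" "(F n x - f x)\<^sup>2 \<le> 9 * (f x)\<^sup>2" if "x \<in> space \<mu>" for n x
  proof -
    have "\<bar>F n x\<bar> \<le> \<bar>2 * f x\<bar>" "\<bar>F n x - f x\<bar> \<le> \<bar>3 * f x\<bar>"
      using F_approx(3)[OF that, of n] by linarith+
    from this[THEN abs_le_square_iff[THEN iffD1]]
    show "(F n x)\<^sup>2 \<le> 4 * (f x)\<^sup>2" "(F n x - f x)\<^sup>2 \<le> 9 * (f x)\<^sup>2"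
      by (simp_all add: power_mult_distrib)
  qed
  show thesis
  proof (rule that)
    show "square_integrable \<mu> (F n)" for n
      unfolding square_integrable_def
    proof
      show "integrable \<mu> (\<lambda>x. (F n x)\<^sup>2)"
        by (rule Bochner_Integration.integrable_bound[of \<mu> "\<lambda>x. 4 * (f x)\<^sup>2"])
          (use f_sq_integrable bound(1) in auto)
    qed simp
    show "(\<lambda>n. \<integral>x. (F n x)\<^sup>2 \<partial>\<mu>) \<longlonglongrightarrow> (\<integral>x. (f x)\<^sup>2 \<partial>\<mu>)"
      using f_sq_integrable bound(1) F_approx(2)
      by (intro integral_dominated_convergence[where w="\<lambda>x. 4 * (f x)\<^sup>2"])
        (auto intro!: tendsto_intros)
    have "(\<lambda>n. (F n x - f x)\<^sup>2) \<longlonglongrightarrow> 0" if "x \<in> space \<mu>" for x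
      using tendsto_power[OF tendsto_diff[OF F_approx(2)[OF that] tendsto_const[of "f x"]], of 2] by simp
    then have "(\<lambda>n. \<integral>x. (F n x - f x)\<^sup>2 \<partial>\<mu>) \<longlonglongrightarrow> (\<integral>x. 0 \<partial>\<mu>)"
      using f_sq_integrable bound(2)
      by (intro integral_dominated_convergence[where w="\<lambda>x. 9 * (f x)\<^sup>2"]) auto
    then show "(\<lambda>n. \<integral>x. (F n x - f x)\<^sup>2 \<partial>\<mu>) \<longlonglongrightarrow> 0" by simp
  qed (rule F_approx(1))
qed

section \<open>Centered normal random variables\<close>

definition normal_law :: "real \<Rightarrow> real measure" where
  "normal_law s = distr std_normal_distribution borel (\<lambda>x. sqrt s * x)"

lemma real_distribution_normal_law: "real_distribution (normal_law s)"
proof -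
  interpret real_distribution std_normal_distribution by (rule real_dist_normal_dist)
  show ?thesis unfolding normal_law_def by simp
qed

lemma char_normal_law:
  assumes "0 \<le> s"
  shows "char (normal_law s) t = complex_of_real (exp (- (s * t\<^sup>2) / 2))"
proof -
  have "char (normal_law s) t = char std_normal_distribution (t * sqrt s)"
    unfolding normal_law_def char_def by (subst integral_distr) (auto simp: mult.assoc)
  then show ?thesis
    using assms by (simp add: char_std_normal_distribution power_mult_distrib mult.commute)
qed

lemma normal_law_0: "normal_law 0 = return borel 0"
proof -
  interpret real_distribution std_normal_distribution by (rule real_dist_normal_dist)
  have "(\<lambda>x. sqrt 0 * x) = (\<lambda>_. 0)" by simp
  then show ?thesis unfolding normal_law_def by (simp only: distr_const) simp
qed

lemma normal_law_eq_density:
  assumes "0 < s"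
  shows "normal_law s = density lborel (\<lambda>x. ennreal (normal_density 0 (sqrt s) x))"
proof -
  interpret real_distribution std_normal_distribution by (rule real_dist_normal_dist)
  have "distributed std_normal_distribution lborel (\<lambda>x. x) std_normal_density"
    by (simp add: distributed_def distr_id2)
  then have "distributed std_normal_distribution lborel (\<lambda>x. 0 + sqrt s * x)
      (normal_density (0 + sqrt s * 0) (\<bar>sqrt s\<bar> * 1))"
    using assms by (intro normal_density_affine) auto
  then show ?thesis
    using assms by (simp add: distributed_def normal_law_def cong: distr_cong)
qed

lemma has_bochner_integral_normal_law_even:
  assumes "0 \<le> s"
  shows "has_bochner_integral (normal_law s) (\<lambda>x. x ^ (2 * k)) (fact (2 * k) / (2 ^ k * fact k) * s ^ k)"
proof -
  have "has_bochner_integral std_normal_distribution (\<lambda>x. s ^ k * x ^ (2 * k))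
      (s ^ k * (fact (2 * k) / (2 ^ k * fact k)))"
    using std_normal_distribution_even_moments[of k]
    by (intro has_bochner_integral_mult_right) (simp add: has_bochner_integral_iff)
  moreover have "(sqrt s * x) ^ (2 * k) = s ^ k * x ^ (2 * k)" for x
    using assms by (simp add: power_mult power_mult_distrib)
  ultimately show ?thesis
    unfolding normal_law_def by (intro has_bochner_integral_distr) (simp_all add: mult.commute)
qed

lemma cmod_iexp_diff_le: "cmod (iexp a - iexp b) \<le> \<bar>a - b\<bar>"
proof -
  have "iexp a - iexp b = iexp b * (iexp (a - b) - 1)"
    by (simp add: algebra_simps flip: exp_add)
  then have "cmod (iexp a - iexp b) = cmod (iexp (a - b) - 1)"
    by (simp add: norm_mult)
  also have "\<dots> \<le> \<bar>a - b\<bar>" using iexp_approx1[of "a - b" 0] by simp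
  finally show ?thesis .
qed

context prob_space
begin

lemma centered_normal_iff_distr:
  "centered_normal M X s \<longleftrightarrow> 0 \<le> s \<and> random_variable borel X \<and> distr M borel X = normal_law s"
proof (cases "random_variable borel X")
  case X_measurable[measurable]: True
  consider (negative) "s < 0" | (zero) "s = 0" | (positive) "0 < s" by linarith
  then show ?thesis
  proof cases
    case zero
    have "(AE \<omega> in M. X \<omega> = 0) \<longleftrightarrow> distr M borel X = return borel 0"
    proof
      assume "AE \<omega> in M. X \<omega> = 0"
      then have "distr M borel X = distr M borel (\<lambda>_. 0)" by (intro distr_cong_AE) auto
      then show "distr M borel X = return borel 0" by (simp add: distr_const)
    next
      assume law: "distr M borel X = return borel 0"
      have "AE x in distr M borel X. x = 0" unfolding law by (subst AE_return) auto
      then show "AE \<omega> in M. X \<omega> = 0" by (subst (asm) AE_distr_iff) auto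
    qed
    then show ?thesis using zero by (simp add: centered_normal_def normal_law_0)
  next
    case positive
    then show ?thesis
      by (simp add: centered_normal_def distributed_def normal_law_eq_density cong: distr_cong)
  qed (simp add: centered_normal_def)
qed (simp add: centered_normal_def)

lemma centered_normal_cong_AE:
  assumes "centered_normal M X s" "AE \<omega> in M. X \<omega> = Y \<omega>" and [measurable]: "random_variable borel Y"
  shows "centered_normal M Y s"
proof -
  have [measurable]: "random_variable borel X" using assms by (simp add: centered_normal_def)
  have "distr M borel X = distr M borel Y"
    using assms(2) by (intro distr_cong_AE) auto
  then show ?thesis using assms(1) by (simp add: centered_normal_iff_distr)
qed

lemma has_bochner_integral_centered_normal_even:
  assumes "centered_normal M X s"
  shows "has_bochner_integral M (\<lambda>\<omega>. X \<omega> ^ (2 * k)) (fact (2 * k) / (2 ^ k * fact k) * s ^ k)"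
proof -
  have [measurable]: "random_variable borel X" and "0 \<le> s" "distr M borel X = normal_law s"
    using assms by (auto simp: centered_normal_iff_distr)
  then have "has_bochner_integral (distr M borel X) (\<lambda>x. x ^ (2 * k)) (fact (2 * k) / (2 ^ k * fact k) * s ^ k)"
    using has_bochner_integral_normal_law_even by simp
  then show ?thesis
    by (simp add: has_bochner_integral_iff integrable_distr_eq integral_distr)
qed

lemma centered_normal_second_moment:
  assumes "centered_normal M X s"
  shows "square_integrable M X" "expectation (\<lambda>\<omega>. (X \<omega>)\<^sup>2) = s"
  using assms has_bochner_integral_centered_normal_even[OF assms, of 1]
  by (auto simp: square_integrable_def centered_normal_def has_bochner_integral_iff)

lemma char_distr_eq:
  assumes [measurable]: "random_variable borel X"
  shows "char (distr M borel X) t = (CLINT \<omega>|M. iexp (t * X \<omega>))"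
  unfolding char_def by (subst integral_distr) auto

lemma char_diff_le:
  fixes X Y :: "'a \<Rightarrow> real"
  assumes [measurable]: "random_variable borel X" "random_variable borel Y"
    and diff_sq_integrable: "integrable M (\<lambda>\<omega>. (X \<omega> - Y \<omega>)\<^sup>2)"
  shows "cmod (char (distr M borel X) t - char (distr M borel Y) t)
    \<le> \<bar>t\<bar> * sqrt (expectation (\<lambda>\<omega>. (X \<omega> - Y \<omega>)\<^sup>2))"
proof -
  have diff_integrable: "integrable M (\<lambda>\<omega>. X \<omega> - Y \<omega>)"
    by (rule square_integrable_imp_integrable) (use diff_sq_integrable in auto)
  have "char (distr M borel X) t - char (distr M borel Y) t =
      (CLINT \<omega>|M. iexp (t * X \<omega>) - iexp (t * Y \<omega>))"
    by (simp only: char_distr_eq assms, rule Bochner_Integration.integral_diff[symmetric];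
        rule integrable_iexp; simp)
  also have "cmod \<dots> \<le> (\<integral>\<omega>. cmod (iexp (t * X \<omega>) - iexp (t * Y \<omega>)) \<partial>M)"
    by (rule integral_norm_bound)
  also have "\<dots> \<le> (\<integral>\<omega>. \<bar>t\<bar> * \<bar>X \<omega> - Y \<omega>\<bar> \<partial>M)"
  proof (rule integral_mono)
    show "integrable M (\<lambda>\<omega>. cmod (iexp (t * X \<omega>) - iexp (t * Y \<omega>)))"
      by (intro integrable_norm Bochner_Integration.integrable_diff; rule integrable_iexp; simp)
    show "cmod (iexp (t * X \<omega>) - iexp (t * Y \<omega>)) \<le> \<bar>t\<bar> * \<bar>X \<omega> - Y \<omega>\<bar>" for \<omega>
      using cmod_iexp_diff_le[of "t * X \<omega>" "t * Y \<omega>"] by (simp add: abs_mult flip: right_diff_distrib)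
  qed (use diff_integrable in auto)
  also have "\<dots> = \<bar>t\<bar> * expectation (\<lambda>\<omega>. \<bar>X \<omega> - Y \<omega>\<bar>)" by simp
  also have "\<dots> \<le> \<bar>t\<bar> * sqrt (expectation (\<lambda>\<omega>. (X \<omega> - Y \<omega>)\<^sup>2))"
  proof -
    have "(expectation (\<lambda>\<omega>. \<bar>X \<omega> - Y \<omega>\<bar>))\<^sup>2 \<le> expectation (\<lambda>\<omega>. (X \<omega> - Y \<omega>)\<^sup>2)"
      using variance_eq[of "\<lambda>\<omega>. \<bar>X \<omega> - Y \<omega>\<bar>"] variance_positive[of "\<lambda>\<omega>. \<bar>X \<omega> - Y \<omega>\<bar>"]
        diff_sq_integrable diff_integrable by simp
    then show ?thesis by (intro mult_left_mono real_le_rsqrt) auto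
  qed
  finally show ?thesis .
qed

lemma centered_normal_L2_limit:
  fixes X :: "nat \<Rightarrow> 'a \<Rightarrow> real"
  assumes normal: "\<And>n. centered_normal M (X n) (s n)"
    and Y_measurable[measurable]: "random_variable borel Y"
    and diff_sq_integrable: "\<And>n. integrable M (\<lambda>\<omega>. (X n \<omega> - Y \<omega>)\<^sup>2)"
    and L2_limit: "(\<lambda>n. expectation (\<lambda>\<omega>. (X n \<omega> - Y \<omega>)\<^sup>2)) \<longlonglongrightarrow> 0"
    and variance_limit: "s \<longlonglongrightarrow> \<sigma>"
  shows "centered_normal M Y \<sigma>"
proof -
  have X_measurable[measurable]: "random_variable borel (X n)"
    and "0 \<le> s n" "distr M borel (X n) = normal_law (s n)" for n
    using normal[of n] by (auto simp: centered_normal_iff_distr)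
  then have char_X: "char (distr M borel (X n)) t = complex_of_real (exp (- (s n * t\<^sup>2) / 2))" for n t
    by (simp add: char_normal_law)
  have "0 \<le> \<sigma>" by (rule LIMSEQ_le_const[OF variance_limit]) (use \<open>\<And>n. 0 \<le> s n\<close> in blast)
  have "char (distr M borel Y) t = complex_of_real (exp (- (\<sigma> * t\<^sup>2) / 2))" for t
  proof (rule LIMSEQ_unique)
    have "(\<lambda>n. \<bar>t\<bar> * sqrt (expectation (\<lambda>\<omega>. (X n \<omega> - Y \<omega>)\<^sup>2))) \<longlonglongrightarrow> \<bar>t\<bar> * sqrt 0"
      by (intro tendsto_intros L2_limit)
    then have bound_limit: "(\<lambda>n. \<bar>t\<bar> * sqrt (expectation (\<lambda>\<omega>. (X n \<omega> - Y \<omega>)\<^sup>2))) \<longlonglongrightarrow> 0" by simp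
    have "(\<lambda>n. char (distr M borel (X n)) t - char (distr M borel Y) t) \<longlonglongrightarrow> 0"
      by (rule Lim_null_comparison[OF always_eventually bound_limit])
        (intro allI char_diff_le X_measurable Y_measurable diff_sq_integrable)
    then show "(\<lambda>n. char (distr M borel (X n)) t) \<longlonglongrightarrow> char (distr M borel Y) t"
      by (simp add: LIM_zero_iff)
    show "(\<lambda>n. char (distr M borel (X n)) t) \<longlonglongrightarrow> complex_of_real (exp (- (\<sigma> * t\<^sup>2) / 2))"
      unfolding char_X by (intro tendsto_intros variance_limit) simp
  qed
  then have "char (distr M borel Y) = char (normal_law \<sigma>)"
    using \<open>0 \<le> \<sigma>\<close> by (simp add: fun_eq_iff char_normal_law)
  then have "distr M borel Y = normal_law \<sigma>"
    by (rule Levy_uniqueness[rotated 2]) (simp_all add: real_distribution_normal_law)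
  then show ?thesis using \<open>0 \<le> \<sigma>\<close> by (simp add: centered_normal_iff_distr)
qed

lemma centered_gaussian_family_lincombE:
  assumes "centered_gaussian_family M S X" "finite J" "J \<subseteq> S"
  obtains s where "centered_normal M (\<lambda>\<omega>. \<Sum>i\<in>J. c i * X i \<omega>) s"
  using assms unfolding centered_gaussian_family_def by blast

lemma centered_gaussian_family_cong_AE:
  assumes gaussian: "centered_gaussian_family M S X"
    and X_eq_Y: "\<And>i. i \<in> S \<Longrightarrow> AE \<omega> in M. X i \<omega> = Y i \<omega>"
    and Y_measurable: "\<And>i. i \<in> S \<Longrightarrow> random_variable borel (Y i)"
  shows "centered_gaussian_family M S Y"
  unfolding centered_gaussian_family_def
proof (intro conjI ballI allI impI)
  fix J c assume J_finite: "finite J \<and> J \<subseteq> S"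
  then obtain s where normal: "centered_normal M (\<lambda>\<omega>. \<Sum>i\<in>J. c i * X i \<omega>) s"
    using centered_gaussian_family_lincombE[OF gaussian] by blast
  have "AE \<omega> in M. \<forall>i\<in>J. X i \<omega> = Y i \<omega>"
    using J_finite X_eq_Y by (intro AE_finite_allI) auto
  then have "AE \<omega> in M. (\<Sum>i\<in>J. c i * X i \<omega>) = (\<Sum>i\<in>J. c i * Y i \<omega>)"
    by eventually_elim simp
  then have "centered_normal M (\<lambda>\<omega>. \<Sum>i\<in>J. c i * Y i \<omega>) s"
    by (rule centered_normal_cong_AE[OF normal])
      (use J_finite Y_measurable in \<open>intro borel_measurable_sum borel_measurable_times; auto\<close>)
  then show "\<exists>s. centered_normal M (\<lambda>\<omega>. \<Sum>i\<in>J. c i * Y i \<omega>) s" ..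
qed (rule Y_measurable)

lemma centered_gaussian_family_square_integrable:
  assumes "centered_gaussian_family M S X" "i \<in> S"
  shows "square_integrable M (X i)"
proof -
  obtain s where "centered_normal M (\<lambda>\<omega>. \<Sum>j\<in>{i}. 1 * X j \<omega>) s"
    by (rule centered_gaussian_family_lincombE[OF assms(1), of "{i}" "\<lambda>_. 1"]) (use assms(2) in auto)
  then show ?thesis using centered_normal_second_moment(1) by simp
qed

lemma centered_normal_lincomb:
  assumes gaussian: "centered_gaussian_family M S X" and J_finite: "finite J" "J \<subseteq> S"
  shows "centered_normal M (\<lambda>\<omega>. \<Sum>i\<in>J. c i * X i \<omega>)
    (\<Sum>i\<in>J. \<Sum>j\<in>J. c i * c j * expectation (\<lambda>\<omega>. X i \<omega> * X j \<omega>))"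
proof -
  obtain s where normal: "centered_normal M (\<lambda>\<omega>. \<Sum>i\<in>J. c i * X i \<omega>) s"
    using assms by (rule centered_gaussian_family_lincombE)
  then have "s = expectation (\<lambda>\<omega>. (\<Sum>i\<in>J. c i * X i \<omega>) * (\<Sum>j\<in>J. c j * X j \<omega>))"
    using centered_normal_second_moment(2)[OF normal] by (simp add: power2_eq_square)
  also have "\<dots> = (\<Sum>i\<in>J. \<Sum>j\<in>J. c i * c j * expectation (\<lambda>\<omega>. X i \<omega> * X j \<omega>))"
    using J_finite
    by (intro integral_sum_mult_sum centered_gaussian_family_square_integrable[OF gaussian]) auto
  finally show ?thesis using normal by simp
qed

lemma centered_normal_increment:
  assumes gaussian: "centered_gaussian_family M S X" and "i \<in> S" "j \<in> S"
  shows "centered_normal M (\<lambda>\<omega>. X i \<omega> - X j \<omega>) (expectation (\<lambda>\<omega>. (X i \<omega> - X j \<omega>)\<^sup>2))"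
proof -
  have "\<exists>s. centered_normal M (\<lambda>\<omega>. X i \<omega> - X j \<omega>) s"
  proof (cases "i = j")
    case False
    obtain s where "centered_normal M (\<lambda>\<omega>. \<Sum>k\<in>{i, j}. (if k = i then 1 else - 1) * X k \<omega>) s"
      by (rule centered_gaussian_family_lincombE[OF gaussian, of "{i, j}"]) (use assms in auto)
    with False show ?thesis by auto
  qed (auto simp: centered_normal_def)
  then obtain s where "centered_normal M (\<lambda>\<omega>. X i \<omega> - X j \<omega>) s" ..
  then show ?thesis using centered_normal_second_moment(2) by metis
qed

end

section \<open>Wiener integrals are Gaussian\<close>

locale wiener = prob_space M for M :: "'w measure" +
  fixes \<mu> :: "'x measure" and W :: "'x set \<Rightarrow> 'w \<Rightarrow> real" and I :: "('x \<Rightarrow> real) \<Rightarrow> 'w \<Rightarrow> real"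
  assumes white_noise: "gaussian_white_noise M \<mu> W"
    and wiener_integral: "wiener_integral M \<mu> W I"
begin

lemma I_measurable [measurable]: "square_integrable \<mu> f \<Longrightarrow> I f \<in> borel_measurable M"
  and I_square_integrable: "square_integrable \<mu> f \<Longrightarrow> integrable M (\<lambda>\<omega>. (I f \<omega>)\<^sup>2)"
  and I_isometry: "square_integrable \<mu> f \<Longrightarrow> (\<integral>\<omega>. (I f \<omega>)\<^sup>2 \<partial>M) = (\<integral>x. (f x)\<^sup>2 \<partial>\<mu>)"
  and I_indicator: "A \<in> finite_measure_sets \<mu> \<Longrightarrow> AE \<omega> in M. I (indicator A) \<omega> = W A \<omega>"
  and I_lincomb: "square_integrable \<mu> f \<Longrightarrow> square_integrable \<mu> g \<Longrightarrow>
    AE \<omega> in M. I (\<lambda>x. a * f x + b * g x) \<omega> = a * I f \<omega> + b * I g \<omega>"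
  using wiener_integral by (simp_all add: wiener_integral_def)

lemma I_zero: "AE \<omega> in M. I (\<lambda>x. 0) \<omega> = 0"
  using I_square_integrable I_isometry by (intro AE_eq_0_if_second_moment_0) simp_all

lemma I_diff_second_moment:
  assumes "square_integrable \<mu> f" "square_integrable \<mu> g"
  shows "integrable M (\<lambda>\<omega>. (I f \<omega> - I g \<omega>)\<^sup>2)"
    and "(\<integral>\<omega>. (I f \<omega> - I g \<omega>)\<^sup>2 \<partial>M) = (\<integral>x. (f x - g x)\<^sup>2 \<partial>\<mu>)"
proof -
  note diff_sq = square_integrable_diff[OF assms]
  note [measurable] = assms[THEN I_measurable] I_measurable[OF diff_sq]
  have "AE \<omega> in M. I (\<lambda>x. f x - g x) \<omega> = I f \<omega> - I g \<omega>"
    using I_lincomb[OF assms, of 1 "-1"] by simp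
  then have I_diff_eq: "AE \<omega> in M. (I (\<lambda>x. f x - g x) \<omega>)\<^sup>2 = (I f \<omega> - I g \<omega>)\<^sup>2"
    by eventually_elim simp
  show "integrable M (\<lambda>\<omega>. (I f \<omega> - I g \<omega>)\<^sup>2)"
    using I_square_integrable[OF diff_sq] integrable_cong_AE[OF _ _ I_diff_eq] by simp
  show "(\<integral>\<omega>. (I f \<omega> - I g \<omega>)\<^sup>2 \<partial>M) = (\<integral>x. (f x - g x)\<^sup>2 \<partial>\<mu>)"
    using I_isometry[OF diff_sq] integral_cong_AE[OF _ _ I_diff_eq] by simp
qed

lemma I_cong_AE:
  assumes "square_integrable \<mu> f" "square_integrable \<mu> g" "AE x in \<mu>. f x = g x"
  shows "AE \<omega> in M. I f \<omega> = I g \<omega>"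
proof -
  have [measurable]: "f \<in> borel_measurable \<mu>" "g \<in> borel_measurable \<mu>"
    using assms by (auto simp: square_integrable_def)
  have "(\<integral>x. (f x - g x)\<^sup>2 \<partial>\<mu>) = (\<integral>x. 0 \<partial>\<mu>)"
    using assms(3) by (intro integral_cong_AE) auto
  then have "AE \<omega> in M. I f \<omega> - I g \<omega> = 0"
    using I_diff_second_moment[OF assms(1,2)] by (intro AE_eq_0_if_second_moment_0) auto
  then show ?thesis by eventually_elim simp
qed

lemma I_sum:
  assumes "finite J" "\<And>i. i \<in> J \<Longrightarrow> square_integrable \<mu> (f i)"
  shows "AE \<omega> in M. I (\<lambda>x. \<Sum>i\<in>J. c i * f i x) \<omega> = (\<Sum>i\<in>J. c i * I (f i) \<omega>)"
  using assms
proof (induction J rule: finite_induct)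
  case empty
  then show ?case using I_zero by simp
next
  case (insert i J)
  have "AE \<omega> in M. I (\<lambda>x. c i * f i x + 1 * (\<Sum>i\<in>J. c i * f i x)) \<omega> =
      c i * I (f i) \<omega> + 1 * I (\<lambda>x. \<Sum>i\<in>J. c i * f i x) \<omega>"
    using insert by (intro I_lincomb square_integrable_sum) auto
  moreover have "AE \<omega> in M. I (\<lambda>x. \<Sum>i\<in>J. c i * f i x) \<omega> = (\<Sum>i\<in>J. c i * I (f i) \<omega>)"
    using insert by auto
  ultimately show ?case
    by eventually_elim (use insert in simp)
qed

lemma I_product:
  assumes "square_integrable \<mu> f" "square_integrable \<mu> g"
  shows "(\<integral>\<omega>. I f \<omega> * I g \<omega> \<partial>M) = (\<integral>x. f x * g x \<partial>\<mu>)"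
proof -
  have polarization: "a * b = (a\<^sup>2 + b\<^sup>2 - (a - b)\<^sup>2) / 2" for a b :: real
    by (simp add: power2_eq_square algebra_simps)
  have "integrable \<mu> (\<lambda>x. (f x)\<^sup>2)" "integrable \<mu> (\<lambda>x. (g x)\<^sup>2)" "integrable \<mu> (\<lambda>x. (f x - g x)\<^sup>2)"
    using assms square_integrable_diff[OF assms] by (auto simp: square_integrable_def)
  then show ?thesis
    unfolding polarization using assms I_diff_second_moment[OF assms]
    by (simp add: I_square_integrable I_isometry)
qed

lemma I_simple_centered_normal:
  assumes F_simple: "simple_function \<mu> F" "square_integrable \<mu> F"
  shows "centered_normal M (I F) (\<integral>x. (F x)\<^sup>2 \<partial>\<mu>)"
proof -
  define Y where "Y = F ` space \<mu> - {0}"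
  define A where "A y = F -` {y} \<inter> space \<mu>" for y
  have "finite Y" using F_simple by (simp add: Y_def simple_function_def)
  have A_finite: "A y \<in> finite_measure_sets \<mu>" if "y \<in> Y" for y
    using that F_simple by (simp add: A_def Y_def level_set_in_finite_measure_sets)
  note A_sq = square_integrable_indicator[OF A_finite]
  have "AE \<omega> in M. I F \<omega> = I (\<lambda>x. \<Sum>y\<in>Y. y * indicator (A y) x) \<omega>"
  proof (intro I_cong_AE F_simple square_integrable_sum A_sq AE_I2)
    show "F x = (\<Sum>y\<in>Y. y * indicator (A y) x)" if "x \<in> space \<mu>" for x
      unfolding Y_def A_def using F_simple(1) that by (rule simple_function_sum_level_sets)
  qed
  moreover have "AE \<omega> in M. I (\<lambda>x. \<Sum>y\<in>Y. y * indicator (A y) x) \<omega> = (\<Sum>y\<in>Y. y * I (indicator (A y)) \<omega>)"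
    using \<open>finite Y\<close> by (intro I_sum A_sq)
  moreover have "AE \<omega> in M. \<forall>y\<in>Y. I (indicator (A y)) \<omega> = W (A y) \<omega>"
    using \<open>finite Y\<close> A_finite by (intro AE_finite_allI I_indicator) auto
  ultimately have I_eq: "AE \<omega> in M. (\<Sum>y\<in>Y. y * W (A y) \<omega>) = I F \<omega>"
    by eventually_elim auto
  have "inj_on A Y"
    by (auto simp: inj_on_def A_def Y_def)
  have W_gaussian: "centered_gaussian_family M (finite_measure_sets \<mu>) W"
    using white_noise by (simp add: gaussian_white_noise_def)
  obtain s where "centered_normal M (\<lambda>\<omega>. \<Sum>B\<in>A ` Y. inv_into Y A B * W B \<omega>) s"
    by (rule centered_gaussian_family_lincombE[OF W_gaussian, of "A ` Y"]) (use A_finite \<open>finite Y\<close> in auto)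
  then have "centered_normal M (\<lambda>\<omega>. \<Sum>y\<in>Y. y * W (A y) \<omega>) s"
    using \<open>inj_on A Y\<close> by (simp add: sum.reindex)
  then have "centered_normal M (I F) s"
    using I_eq I_measurable[OF F_simple(2)] by (rule centered_normal_cong_AE)
  then show ?thesis
    using centered_normal_second_moment(2) I_isometry[OF F_simple(2)] by metis
qed

lemma I_centered_normal:
  assumes f_sq: "square_integrable \<mu> f"
  shows "centered_normal M (I f) (\<integral>x. (f x)\<^sup>2 \<partial>\<mu>)"
proof -
  obtain F where F_simple: "\<And>n. simple_function \<mu> (F n)" "\<And>n. square_integrable \<mu> (F n)"
    and second_moment: "(\<lambda>n. \<integral>x. (F n x)\<^sup>2 \<partial>\<mu>) \<longlonglongrightarrow> (\<integral>x. (f x)\<^sup>2 \<partial>\<mu>)"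
    and L2_limit: "(\<lambda>n. \<integral>x. (F n x - f x)\<^sup>2 \<partial>\<mu>) \<longlonglongrightarrow> 0"
    using f_sq by (rule square_integrable_simple_approx) blast
  show ?thesis
  proof (rule centered_normal_L2_limit)
    show "centered_normal M (I (F n)) (\<integral>x. (F n x)\<^sup>2 \<partial>\<mu>)" for n
      using F_simple by (rule I_simple_centered_normal)
  qed (use f_sq F_simple second_moment L2_limit I_diff_second_moment[OF F_simple(2) f_sq] in auto)
qed

lemma I_centered_gaussian_family:
  assumes "\<And>i. i \<in> S \<Longrightarrow> square_integrable \<mu> (f i)"
  shows "centered_gaussian_family M S (\<lambda>i. I (f i))"
  unfolding centered_gaussian_family_def
proof (intro conjI ballI allI impI)
  fix J c assume J_finite: "finite J \<and> J \<subseteq> S"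
  then have f_sq: "\<And>i. i \<in> J \<Longrightarrow> square_integrable \<mu> (f i)"
    using assms by auto
  then have "centered_normal M (I (\<lambda>x. \<Sum>i\<in>J. c i * f i x)) (\<integral>x. (\<Sum>i\<in>J. c i * f i x)\<^sup>2 \<partial>\<mu>)"
    by (intro I_centered_normal square_integrable_sum)
  moreover have "AE \<omega> in M. I (\<lambda>x. \<Sum>i\<in>J. c i * f i x) \<omega> = (\<Sum>i\<in>J. c i * I (f i) \<omega>)"
    using J_finite f_sq by (intro I_sum) auto
  moreover have "(\<lambda>\<omega>. \<Sum>i\<in>J. c i * I (f i) \<omega>) \<in> borel_measurable M"
    using f_sq by (intro borel_measurable_sum borel_measurable_times I_measurable) auto
  ultimately have "centered_normal M (\<lambda>\<omega>. \<Sum>i\<in>J. c i * I (f i) \<omega>) (\<integral>x. (\<Sum>i\<in>J. c i * f i x)\<^sup>2 \<partial>\<mu>)"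
    by (rule centered_normal_cong_AE)
  then show "\<exists>s. centered_normal M (\<lambda>\<omega>. \<Sum>i\<in>J. c i * I (f i) \<omega>) s" ..
qed (use assms in auto)

end

section \<open>Joint laws are determined by linear combinations\<close>

lemma weighted_law:
  fixes X :: "'a \<Rightarrow> real" and g :: "'a \<Rightarrow> real"
  assumes [measurable]: "X \<in> borel_measurable M"
    and weight: "integrable M g" "\<And>\<omega>. 0 \<le> g \<omega>" "0 < integral\<^sup>L M g"
  defines "\<nu> \<equiv> distr (density M (\<lambda>\<omega>. ennreal (g \<omega> / integral\<^sup>L M g))) borel X"
  shows "real_distribution \<nu>"
    and "char \<nu> t = (CLINT \<omega>|M. complex_of_real (g \<omega>) * iexp (t * X \<omega>)) / integral\<^sup>L M g"
    and "B \<in> sets borel \<Longrightarrow> (\<integral>x. indicator B x \<partial>\<nu>) = (\<integral>\<omega>. g \<omega> * indicator B (X \<omega>) \<partial>M) / integral\<^sup>L M g"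
proof -
  let ?c = "integral\<^sup>L M g"
  have [measurable]: "g \<in> borel_measurable M" using weight(1) by simp
  have "emeasure (density M (\<lambda>\<omega>. ennreal (g \<omega> / ?c))) (space M) = (\<integral>\<^sup>+\<omega>. ennreal (g \<omega> / ?c) \<partial>M)"
    by (subst emeasure_density) (auto intro!: nn_integral_cong)
  also have "\<dots> = ennreal (\<integral>\<omega>. g \<omega> / ?c \<partial>M)"
    using weight by (intro nn_integral_eq_integral) auto
  also have "\<dots> = 1" using weight by simp
  finally interpret prob_space "density M (\<lambda>\<omega>. ennreal (g \<omega> / ?c))"
    by (intro prob_spaceI) simp
  show "real_distribution \<nu>"
    unfolding \<nu>_def by (rule real_distribution_distr) simp
  show "char \<nu> t = (CLINT \<omega>|M. complex_of_real (g \<omega>) * iexp (t * X \<omega>)) / ?c"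
    unfolding \<nu>_def char_def using weight
    by (simp add: integral_distr integral_density scaleR_conv_of_real)
  show "(\<integral>x. indicator B x \<partial>\<nu>) = (\<integral>\<omega>. g \<omega> * indicator B (X \<omega>) \<partial>M) / ?c"
    if [measurable]: "B \<in> sets borel"
  proof -
    have "(\<integral>x. indicator B x \<partial>\<nu>) =
        (\<integral>\<omega>. indicat_real B (X \<omega>) \<partial>density M (\<lambda>\<omega>. ennreal (g \<omega> / ?c)))"
      unfolding \<nu>_def by (subst integral_distr) auto
    also have "\<dots> = (\<integral>\<omega>. (g \<omega> / ?c) *\<^sub>R indicator B (X \<omega>) \<partial>M)"
      using weight by (subst integral_density) auto
    finally show ?thesis by simp
  qed
qed

lemma integral_weight_indicator_eqI_char:
  fixes X :: "'a \<Rightarrow> real" and g :: "'a \<Rightarrow> real" and Y :: "'b \<Rightarrow> real" and h :: "'b \<Rightarrow> real"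
  assumes X_measurable: "X \<in> borel_measurable M"
    and weight_g: "integrable M g" "\<And>\<omega>. 0 \<le> g \<omega>" "0 < integral\<^sup>L M g"
    and Y_measurable: "Y \<in> borel_measurable N"
    and weight_h: "integrable N h" "\<And>\<omega>. 0 \<le> h \<omega>"
    and B_measurable: "B \<in> sets borel"
    and char: "\<And>t. (CLINT \<omega>|M. complex_of_real (g \<omega>) * iexp (t * X \<omega>)) =
      (CLINT \<omega>|N. complex_of_real (h \<omega>) * iexp (t * Y \<omega>))"
  shows "(\<integral>\<omega>. g \<omega> * indicator B (X \<omega>) \<partial>M) = (\<integral>\<omega>. h \<omega> * indicator B (Y \<omega>) \<partial>N)"
proof -
  let ?c = "integral\<^sup>L M g"
  have mass: "integral\<^sup>L N h = ?c" using char[of 0] by simp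
  let ?\<mu> = "distr (density M (\<lambda>\<omega>. ennreal (g \<omega> / ?c))) borel X"
    and ?\<nu> = "distr (density N (\<lambda>\<omega>. ennreal (h \<omega> / ?c))) borel Y"
  note law_X = weighted_law[OF X_measurable weight_g]
  note law_Y = weighted_law[OF Y_measurable weight_h, unfolded mass, OF weight_g(3)]
  have "?\<mu> = ?\<nu>"
    by (rule Levy_uniqueness[OF law_X(1) law_Y(1)], rule ext) (simp only: law_X(2) law_Y(2) char)
  then have "(\<integral>x. indicat_real B x \<partial>?\<mu>) = (\<integral>x. indicator B x \<partial>?\<nu>)" by (rule arg_cong)
  then show ?thesis
    unfolding law_X(3)[OF B_measurable] law_Y(3)[OF B_measurable] using weight_g(3) by simp
qed

definition cylinder_weight ::
  "('i \<Rightarrow> real set) \<Rightarrow> ('i \<Rightarrow> real) \<Rightarrow> 'i set \<Rightarrow> 'i set \<Rightarrow> ('i \<Rightarrow> real) \<Rightarrow> complex" where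
  "cylinder_weight B t K L z = (\<Prod>j\<in>K. indicator (B j) (z j)) * iexp (\<Sum>j\<in>L. t j * z j)"

lemma cylinder_weight_measurable:
  assumes "\<And>j. j \<in> J \<Longrightarrow> X j \<in> borel_measurable M" "\<And>j. j \<in> J \<Longrightarrow> B j \<in> sets borel" "K \<subseteq> J" "L \<subseteq> J"
  shows "(\<lambda>\<omega>. cylinder_weight B t K L (\<lambda>j. X j \<omega>)) \<in> borel_measurable M"
proof -
  have [measurable]: "(\<lambda>\<omega>. \<Prod>j\<in>K. indicator (B j) (X j \<omega>) :: complex) \<in> borel_measurable M"
    "(\<lambda>\<omega>. \<Sum>j\<in>L. t j * X j \<omega>) \<in> borel_measurable M"
    using assms
    by (auto intro!: borel_measurable_prod borel_measurable_sum borel_measurable_times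
        measurable_compose[OF _ borel_measurable_indicator])
  show ?thesis unfolding cylinder_weight_def by measurable
qed

lemma cylinder_weight_bound: "cmod (cylinder_weight B t K L z) \<le> 1"
  by (auto simp: cylinder_weight_def norm_mult prod_norm[symmetric] indicator_def intro!: prod_le_1)

lemma cylinder_weight_mult_indicator:
  assumes "finite K" "k \<notin> K"
  shows "cylinder_weight B t K L z * indicator (B k) (z k) = cylinder_weight B t (insert k K) L z"
  using assms by (simp add: cylinder_weight_def mult_ac)

lemma cylinder_weight_mult_iexp:
  assumes "finite L" "k \<notin> L"
  shows "cylinder_weight B t K L z * iexp (r * z k) = cylinder_weight B (t(k := r)) K (insert k L) z"
proof -
  have "(\<Sum>j\<in>insert k L. (t(k := r)) j * z j) = r * z k + (\<Sum>j\<in>L. t j * z j)"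
    using assms by (auto intro!: sum.cong)
  then show ?thesis
    unfolding cylinder_weight_def by (simp add: mult.assoc distrib_left add.commute flip: exp_add)
qed

lemma (in prob_space) emeasure_distr_PiE:
  assumes finite_J: "finite J" and X_measurable: "\<And>j. j \<in> J \<Longrightarrow> random_variable borel (X j)"
    and B_measurable: "\<And>j. j \<in> J \<Longrightarrow> B j \<in> sets borel"
  shows "emeasure (distr M (PiM J (\<lambda>_. borel)) (\<lambda>\<omega>. \<lambda>j\<in>J. X j \<omega>)) (Pi\<^sub>E J B) =
    ennreal (\<integral>\<omega>. (\<Prod>j\<in>J. indicator (B j) (X j \<omega>)) \<partial>M)"
proof -
  let ?A = "(\<lambda>\<omega>. \<lambda>j\<in>J. X j \<omega>) -` Pi\<^sub>E J B \<inter> space M"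
  have restrict_measurable: "(\<lambda>\<omega>. \<lambda>j\<in>J. X j \<omega>) \<in> measurable M (PiM J (\<lambda>_. borel))"
    using X_measurable by (rule measurable_restrict)
  have box_measurable: "Pi\<^sub>E J B \<in> sets (PiM J (\<lambda>_. borel))"
    using finite_J B_measurable by (intro sets_PiM_I_finite)
  have "indicator ?A \<omega> = (\<Prod>j\<in>J. indicator (B j) (X j \<omega>) :: real)" if "\<omega> \<in> space M" for \<omega>
  proof (cases "\<forall>j\<in>J. X j \<omega> \<in> B j")
    case False
    then have "\<exists>j\<in>J. indicat_real (B j) (X j \<omega>) = 0" by (auto simp: indicator_def)
    then show ?thesis using False finite_J by (auto simp: indicator_def PiE_iff prod_zero)
  qed (use that in auto)
  then have "(\<integral>\<omega>. (\<Prod>j\<in>J. indicator (B j) (X j \<omega>)) \<partial>M) = (\<integral>\<omega>. indicat_real ?A \<omega> \<partial>M)"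
    by (intro Bochner_Integration.integral_cong) auto
  also have "ennreal \<dots> = emeasure M ?A"
    using measurable_sets[OF restrict_measurable box_measurable] by (simp add: emeasure_eq_measure)
  finally show ?thesis by (simp only: emeasure_distr[OF restrict_measurable box_measurable])
qed

text \<open>Levy's uniqueness theorem needs positive weights; adding \<open>2\<close> to a weight bounded by \<open>1\<close> makes
  it positive.\<close>

lemma (in prob_space) CLINT_shifted_Re_weight:
  fixes w :: "'a \<Rightarrow> complex"
  assumes [measurable]: "random_variable borel w" "random_variable borel X"
    and bound: "\<And>\<omega>. cmod (w \<omega>) \<le> 1"
  shows "(CLINT \<omega>|M. complex_of_real (2 + Re (w \<omega>)) * iexp (t * X \<omega>)) =
    2 * (CLINT \<omega>|M. iexp (t * X \<omega>)) +
    ((CLINT \<omega>|M. w \<omega> * iexp (t * X \<omega>)) + cnj (CLINT \<omega>|M. w \<omega> * iexp (- t * X \<omega>))) / 2"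
proof -
  have weighted_integrable: "integrable M (\<lambda>\<omega>. w \<omega> * iexp (s * X \<omega>))" for s
    using bound by (intro integrable_const_bound[where B=1]) (auto simp: norm_mult)
  have weighted_cnj_integrable: "integrable M (\<lambda>\<omega>. cnj (w \<omega> * iexp (s * X \<omega>)))" for s
    using weighted_integrable by (simp only: complex_integrable_cnj)
  have "complex_of_real (2 + Re (w \<omega>)) * iexp (t * X \<omega>) =
      2 * iexp (t * X \<omega>) + (w \<omega> * iexp (t * X \<omega>) + cnj (w \<omega> * iexp (- t * X \<omega>))) / 2" for \<omega>
  proof -
    have "complex_of_real (Re (w \<omega>)) = (w \<omega> + cnj (w \<omega>)) / 2"
      by (simp add: complex_add_cnj)
    moreover have "cnj (iexp (- t * X \<omega>)) = iexp (t * X \<omega>)" by (simp add: exp_cnj)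
    ultimately show ?thesis by (simp add: algebra_simps add_divide_distrib)
  qed
  then have "(CLINT \<omega>|M. complex_of_real (2 + Re (w \<omega>)) * iexp (t * X \<omega>)) =
      (CLINT \<omega>|M. 2 * iexp (t * X \<omega>) + (w \<omega> * iexp (t * X \<omega>) + cnj (w \<omega> * iexp (- t * X \<omega>))) / 2)"
    by (simp only:)
  also have "\<dots> = 2 * (CLINT \<omega>|M. iexp (t * X \<omega>)) +
      ((CLINT \<omega>|M. w \<omega> * iexp (t * X \<omega>)) + (CLINT \<omega>|M. cnj (w \<omega> * iexp (- t * X \<omega>)))) / 2"
    using weighted_integrable[of t] weighted_cnj_integrable[of "- t"]
    by (simp add: integrable_iexp del: complex_cnj_mult)
  finally show ?thesis by (simp only: Bochner_Integration.integral_cnj)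
qed

context pair_prob_space
begin

lemma integral_Re_weight_indicator_eqI_char:
  fixes w :: "'a \<Rightarrow> complex" and v :: "'b \<Rightarrow> complex"
  assumes [measurable]: "w \<in> borel_measurable M1" "X \<in> borel_measurable M1"
      "v \<in> borel_measurable M2" "Y \<in> borel_measurable M2" "B \<in> sets borel"
    and bound: "\<And>\<omega>. cmod (w \<omega>) \<le> 1" "\<And>\<omega>. cmod (v \<omega>) \<le> 1"
    and char: "\<And>t. (CLINT \<omega>|M1. iexp (t * X \<omega>)) = (CLINT \<omega>|M2. iexp (t * Y \<omega>))"
    and weighted_char: "\<And>t. (CLINT \<omega>|M1. w \<omega> * iexp (t * X \<omega>)) = (CLINT \<omega>|M2. v \<omega> * iexp (t * Y \<omega>))"
  shows "(\<integral>\<omega>. Re (w \<omega>) * indicator B (X \<omega>) \<partial>M1) = (\<integral>\<omega>. Re (v \<omega>) * indicator B (Y \<omega>) \<partial>M2)"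
proof -
  have Re_bound: "\<bar>Re (w \<omega>)\<bar> \<le> 1" "\<bar>Re (v \<omega>')\<bar> \<le> 1" for \<omega> \<omega>'
    using order_trans[OF abs_Re_le_cmod] bound by blast+
  have weights_integrable: "integrable M1 (\<lambda>\<omega>. Re (w \<omega>))" "integrable M2 (\<lambda>\<omega>. Re (v \<omega>))"
    "integrable M1 (\<lambda>\<omega>. indicat_real B (X \<omega>))" "integrable M2 (\<lambda>\<omega>. indicat_real B (Y \<omega>))"
    "integrable M1 (\<lambda>\<omega>. Re (w \<omega>) * indicator B (X \<omega>))" "integrable M2 (\<lambda>\<omega>. Re (v \<omega>) * indicator B (Y \<omega>))"
    using Re_bound
    by (auto intro!: M1.integrable_const_bound[where B=1] M2.integrable_const_bound[where B=1]
        simp: indicator_def)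
  have shifted_pos: "0 \<le> 2 + Re (w \<omega>)" "0 \<le> 2 + Re (v \<omega>')" "1 \<le> 2 + Re (w \<omega>)" for \<omega> \<omega>'
    using Re_bound(1)[of \<omega>] Re_bound(2)[of \<omega>'] by linarith+
  have "1 \<le> (\<integral>\<omega>. 2 + Re (w \<omega>) \<partial>M1)"
    using shifted_pos weights_integrable by (intro M1.integral_ge_const) auto
  then have "(\<integral>\<omega>. (2 + Re (w \<omega>)) * indicator B (X \<omega>) \<partial>M1) = (\<integral>\<omega>. (2 + Re (v \<omega>)) * indicator B (Y \<omega>) \<partial>M2)"
    using shifted_pos weights_integrable
    by (intro integral_weight_indicator_eqI_char)
      (auto simp only: M1.CLINT_shifted_Re_weight M2.CLINT_shifted_Re_weight assms
        intro!: Bochner_Integration.integrable_add integrable_const)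
  moreover have "(\<integral>\<omega>. 1 * indicat_real B (X \<omega>) \<partial>M1) = (\<integral>\<omega>. 1 * indicator B (Y \<omega>) \<partial>M2)"
    using char by (intro integral_weight_indicator_eqI_char) (auto simp: M1.prob_space)
  ultimately show ?thesis
    using weights_integrable by (simp add: distrib_right)
qed

lemma CLINT_weight_indicator_eqI_char:
  fixes w :: "'a \<Rightarrow> complex" and v :: "'b \<Rightarrow> complex"
  assumes measurable[measurable]: "w \<in> borel_measurable M1" "X \<in> borel_measurable M1"
      "v \<in> borel_measurable M2" "Y \<in> borel_measurable M2" "B \<in> sets borel"
    and bound: "\<And>\<omega>. cmod (w \<omega>) \<le> 1" "\<And>\<omega>. cmod (v \<omega>) \<le> 1"
    and char: "\<And>t. (CLINT \<omega>|M1. iexp (t * X \<omega>)) = (CLINT \<omega>|M2. iexp (t * Y \<omega>))"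
    and weighted_char: "\<And>t. (CLINT \<omega>|M1. w \<omega> * iexp (t * X \<omega>)) = (CLINT \<omega>|M2. v \<omega> * iexp (t * Y \<omega>))"
  shows "(CLINT \<omega>|M1. w \<omega> * indicator B (X \<omega>)) = (CLINT \<omega>|M2. v \<omega> * indicator B (Y \<omega>))"
proof (rule complex_eqI)
  have weights_integrable: "integrable M1 (\<lambda>\<omega>. w \<omega> * indicator B (X \<omega>))"
    "integrable M2 (\<lambda>\<omega>. v \<omega> * indicator B (Y \<omega>))"
    using bound
    by (auto intro!: M1.integrable_const_bound[where B=1] M2.integrable_const_bound[where B=1]
        simp: indicator_def)
  have Re_eq: "(\<integral>\<omega>. Re (w \<omega>) * indicator B (X \<omega>) \<partial>M1) = (\<integral>\<omega>. Re (v \<omega>) * indicator B (Y \<omega>) \<partial>M2)"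
    by (rule integral_Re_weight_indicator_eqI_char) (fact measurable bound char weighted_char)+
  have "(CLINT \<omega>|M1. - \<i> * w \<omega> * iexp (t * X \<omega>)) = (CLINT \<omega>|M2. - \<i> * v \<omega> * iexp (t * Y \<omega>))" for t
    by (simp only: mult.assoc[of "- \<i>"] integral_mult_right_zero weighted_char)
  then have Im_eq: "(\<integral>\<omega>. Re (- \<i> * w \<omega>) * indicator B (X \<omega>) \<partial>M1) =
      (\<integral>\<omega>. Re (- \<i> * v \<omega>) * indicator B (Y \<omega>) \<partial>M2)"
    using bound char by (intro integral_Re_weight_indicator_eqI_char) (auto simp: norm_mult)
  have parts: "Re (z * indicator B x) = Re z * indicator B x"
    "Im (z * indicator B x) = Re (- \<i> * z) * indicator B x"
    for z :: complex and x :: real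
    by (simp_all add: indicator_def)
  show "Re (CLINT \<omega>|M1. w \<omega> * indicator B (X \<omega>)) = Re (CLINT \<omega>|M2. v \<omega> * indicator B (Y \<omega>))"
    using Re_eq by (simp only: parts flip: weights_integrable[THEN integral_Re])
  show "Im (CLINT \<omega>|M1. w \<omega> * indicator B (X \<omega>)) = Im (CLINT \<omega>|M2. v \<omega> * indicator B (Y \<omega>))"
    using Im_eq by (simp only: parts flip: weights_integrable[THEN integral_Im])
qed

lemma CLINT_cylinder_weight_eqI_char:
  fixes X :: "'i \<Rightarrow> 'a \<Rightarrow> real" and Y :: "'i \<Rightarrow> 'b \<Rightarrow> real"
  assumes finite_J: "finite J"
    and X_measurable: "\<And>j. j \<in> J \<Longrightarrow> X j \<in> borel_measurable M1"
    and Y_measurable: "\<And>j. j \<in> J \<Longrightarrow> Y j \<in> borel_measurable M2"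
    and B_measurable: "\<And>j. j \<in> J \<Longrightarrow> B j \<in> sets borel"
    and char: "\<And>t. (CLINT \<omega>|M1. iexp (\<Sum>j\<in>J. t j * X j \<omega>)) = (CLINT \<omega>|M2. iexp (\<Sum>j\<in>J. t j * Y j \<omega>))"
    and "K \<subseteq> J"
  shows "(CLINT \<omega>|M1. cylinder_weight B t K (J - K) (\<lambda>j. X j \<omega>)) =
    (CLINT \<omega>|M2. cylinder_weight B t K (J - K) (\<lambda>j. Y j \<omega>))"
  using finite_subset[OF \<open>K \<subseteq> J\<close> finite_J] \<open>K \<subseteq> J\<close>
proof (induction K arbitrary: t rule: finite_induct)
  case empty
  then show ?case using char by (simp add: cylinder_weight_def)
next
  case (insert k K)
  define L where "L = J - insert k K"
  have in_J: "k \<in> J" "K \<subseteq> J" "L \<subseteq> J" and L: "finite L" "k \<notin> L"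
    using insert.prems finite_J by (auto simp: L_def)
  have J_minus_K: "J - K = insert k L" using in_J insert.hyps by (auto simp: L_def)
  have weight_measurable: "(\<lambda>\<omega>. cylinder_weight B t K L (\<lambda>j. X j \<omega>)) \<in> borel_measurable M1"
    "(\<lambda>\<omega>. cylinder_weight B t K L (\<lambda>j. Y j \<omega>)) \<in> borel_measurable M2"
    using in_J
    by (auto intro!: cylinder_weight_measurable[where J=J] X_measurable Y_measurable B_measurable)
  have "(CLINT \<omega>|M1. cylinder_weight B t K L (\<lambda>j. X j \<omega>) * indicator (B k) (X k \<omega>)) =
      (CLINT \<omega>|M2. cylinder_weight B t K L (\<lambda>j. Y j \<omega>) * indicator (B k) (Y k \<omega>))"
  proof (rule CLINT_weight_indicator_eqI_char[OF weight_measurable(1) X_measurable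
        weight_measurable(2) Y_measurable B_measurable])
    fix r :: real
    have "(\<Sum>j\<in>J. (if j = k then r else 0) * Z j) = r * Z k" for Z :: "'i \<Rightarrow> real"
      using in_J finite_J by (simp add: if_distrib[of "\<lambda>x. x * _"] cong: if_cong)
    then show "(CLINT \<omega>|M1. iexp (r * X k \<omega>)) = (CLINT \<omega>|M2. iexp (r * Y k \<omega>))"
      using char[of "\<lambda>j. if j = k then r else 0"] by simp
    show "(CLINT \<omega>|M1. cylinder_weight B t K L (\<lambda>j. X j \<omega>) * iexp (r * X k \<omega>)) =
        (CLINT \<omega>|M2. cylinder_weight B t K L (\<lambda>j. Y j \<omega>) * iexp (r * Y k \<omega>))"
      using insert.IH[OF in_J(2), of "t(k := r)"]
      by (simp only: J_minus_K cylinder_weight_mult_iexp[OF L, symmetric])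
  qed (use in_J cylinder_weight_bound in auto)
  then show ?case
    by (simp only: L_def[symmetric] cylinder_weight_mult_indicator[OF insert.hyps(1,2), symmetric])
qed

lemma distr_PiM_eqI_char:
  fixes X :: "'i \<Rightarrow> 'a \<Rightarrow> real" and Y :: "'i \<Rightarrow> 'b \<Rightarrow> real"
  assumes finite_J: "finite J"
    and X_measurable: "\<And>j. j \<in> J \<Longrightarrow> X j \<in> borel_measurable M1"
    and Y_measurable: "\<And>j. j \<in> J \<Longrightarrow> Y j \<in> borel_measurable M2"
    and char: "\<And>t. (CLINT \<omega>|M1. iexp (\<Sum>j\<in>J. t j * X j \<omega>)) = (CLINT \<omega>|M2. iexp (\<Sum>j\<in>J. t j * Y j \<omega>))"
  shows "distr M1 (PiM J (\<lambda>_. borel)) (\<lambda>\<omega>. \<lambda>j\<in>J. X j \<omega>) = distr M2 (PiM J (\<lambda>_. borel)) (\<lambda>\<omega>. \<lambda>j\<in>J. Y j \<omega>)"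
proof (rule measure_eqI_PiM_finite[OF finite_J])
  fix B :: "'i \<Rightarrow> real set" assume B_measurable: "\<And>j. j \<in> J \<Longrightarrow> B j \<in> sets borel"
  have "complex_of_real (\<integral>\<omega>. (\<Prod>j\<in>J. indicator (B j) (X j \<omega>)) \<partial>M1) =
      complex_of_real (\<integral>\<omega>. (\<Prod>j\<in>J. indicator (B j) (Y j \<omega>)) \<partial>M2)"
    using CLINT_cylinder_weight_eqI_char[where B=B and K=J,
        OF finite_J X_measurable Y_measurable B_measurable char order_refl]
    by (simp add: cylinder_weight_def of_real_indicator flip: integral_complex_of_real)
  then show "emeasure (distr M1 (PiM J (\<lambda>_. borel)) (\<lambda>\<omega>. \<lambda>j\<in>J. X j \<omega>)) (Pi\<^sub>E J B) =
      emeasure (distr M2 (PiM J (\<lambda>_. borel)) (\<lambda>\<omega>. \<lambda>j\<in>J. Y j \<omega>)) (Pi\<^sub>E J B)"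
    by (simp only: M1.emeasure_distr_PiE[where B=B, OF finite_J X_measurable B_measurable]
        M2.emeasure_distr_PiE[where B=B, OF finite_J Y_measurable B_measurable] of_real_eq_iff)
next
  show "range (\<lambda>_::nat. space (PiM J (\<lambda>_. borel :: real measure))) \<subseteq> prod_algebra J (\<lambda>_. borel)"
    using finite_J by (auto simp: space_PiM intro!: prod_algebraI_finite)
  have "prob_space (distr M1 (PiM J (\<lambda>_. borel)) (\<lambda>\<omega>. \<lambda>j\<in>J. X j \<omega>))"
    using X_measurable by (intro M1.prob_space_distr measurable_restrict)
  then show "emeasure (distr M1 (PiM J (\<lambda>_. borel)) (\<lambda>\<omega>. \<lambda>j\<in>J. X j \<omega>)) (space (PiM J (\<lambda>_. borel))) \<noteq> \<infinity>"
    by (metis prob_space.emeasure_space_1 space_distr infinity_ennreal_def ennreal_one_neq_top)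
qed auto

lemma distr_PiM_eqI_centered_normal:
  fixes X :: "'i \<Rightarrow> 'a \<Rightarrow> real" and Y :: "'i \<Rightarrow> 'b \<Rightarrow> real"
  assumes "finite J"
    and "\<And>j. j \<in> J \<Longrightarrow> X j \<in> borel_measurable M1" "\<And>j. j \<in> J \<Longrightarrow> Y j \<in> borel_measurable M2"
    and normal_X: "\<And>t. centered_normal M1 (\<lambda>\<omega>. \<Sum>j\<in>J. t j * X j \<omega>) (s t)"
    and normal_Y: "\<And>t. centered_normal M2 (\<lambda>\<omega>. \<Sum>j\<in>J. t j * Y j \<omega>) (s t)"
  shows "distr M1 (PiM J (\<lambda>_. borel)) (\<lambda>\<omega>. \<lambda>j\<in>J. X j \<omega>) = distr M2 (PiM J (\<lambda>_. borel)) (\<lambda>\<omega>. \<lambda>j\<in>J. Y j \<omega>)"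
proof (rule distr_PiM_eqI_char)
  fix t
  have "char (distr M1 borel (\<lambda>\<omega>. \<Sum>j\<in>J. t j * X j \<omega>)) 1 = char (distr M2 borel (\<lambda>\<omega>. \<Sum>j\<in>J. t j * Y j \<omega>)) 1"
    using normal_X[of t] normal_Y[of t] by (simp add: M1.centered_normal_iff_distr M2.centered_normal_iff_distr)
  then show "(CLINT \<omega>|M1. iexp (\<Sum>j\<in>J. t j * X j \<omega>)) = (CLINT \<omega>|M2. iexp (\<Sum>j\<in>J. t j * Y j \<omega>))"
    using normal_X[of t] normal_Y[of t] by (simp add: centered_normal_def M1.char_distr_eq M2.char_distr_eq)
qed fact+

end

lemma (in prob_space) stationary_process_if_shift_invariant_covariance:
  fixes Z :: "real \<Rightarrow> 'a \<Rightarrow> real"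
  assumes gaussian: "centered_gaussian_family M UNIV Z"
    and shift: "\<And>u v h. expectation (\<lambda>\<omega>. Z (u + h) \<omega> * Z (v + h) \<omega>) = expectation (\<lambda>\<omega>. Z u \<omega> * Z v \<omega>)"
  shows "stationary_process M Z"
  unfolding stationary_process_def
proof (intro allI impI)
  fix J :: "real set" and h :: real assume finite_J: "finite J"
  interpret MM: pair_prob_space M M ..
  have Z_measurable: "Z u \<in> borel_measurable M" for u
    using gaussian by (simp add: centered_gaussian_family_def)
  have shifted: "centered_normal M (\<lambda>\<omega>. \<Sum>i\<in>J. t i * Z (i + h) \<omega>)
      (\<Sum>i\<in>J. \<Sum>j\<in>J. t i * t j * expectation (\<lambda>\<omega>. Z i \<omega> * Z j \<omega>))" for t
    using centered_normal_lincomb[OF gaussian, of "(\<lambda>i. i + h) ` J" "\<lambda>i. t (i - h)"] finite_J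
    by (simp add: sum.reindex shift)
  show "distr M (PiM J (\<lambda>_. borel)) (\<lambda>\<omega>. \<lambda>i\<in>J. Z (i + h) \<omega>) =
      distr M (PiM J (\<lambda>_. borel)) (\<lambda>\<omega>. \<lambda>i\<in>J. Z i \<omega>)"
    using shifted centered_normal_lincomb[OF gaussian finite_J]
    by (intro MM.distr_PiM_eqI_centered_normal finite_J Z_measurable) auto
qed

section \<open>Hoelder continuous versions\<close>

definition dyadic_floor :: "nat \<Rightarrow> real \<Rightarrow> real" where
  "dyadic_floor n u = real_of_int \<lfloor>2 ^ n * u\<rfloor> / 2 ^ n"

definition dyadic_limit :: "(real \<Rightarrow> real) \<Rightarrow> real \<Rightarrow> real" where
  "dyadic_limit f u = lim (\<lambda>n. f (dyadic_floor n u))"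

definition dyadic_increment :: "(real \<Rightarrow> real) \<Rightarrow> nat \<Rightarrow> int \<Rightarrow> real" where
  "dyadic_increment f n k = f (real_of_int (k + 1) / 2 ^ n) - f (real_of_int k / 2 ^ n)"

definition dyadic_holder :: "real \<Rightarrow> real \<Rightarrow> nat \<Rightarrow> (real \<Rightarrow> real) \<Rightarrow> bool" where
  "dyadic_holder \<alpha> K N f \<longleftrightarrow>
    (\<forall>n k. \<bar>k\<bar> \<le> int N * 2 ^ n \<longrightarrow> \<bar>dyadic_increment f n k\<bar> \<le> K * (2 powr - \<alpha>) ^ n)"

lemma dyadic_holderD:
  "dyadic_holder \<alpha> K N f \<Longrightarrow> \<bar>k\<bar> \<le> int N * 2 ^ n \<Longrightarrow> \<bar>dyadic_increment f n k\<bar> \<le> K * (2 powr - \<alpha>) ^ n"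
  unfolding dyadic_holder_def by blast

lemma dyadic_holder_nonneg: "dyadic_holder \<alpha> K N f \<Longrightarrow> 0 \<le> K"
  using dyadic_holderD[of \<alpha> K N f 0 0] by simp

lemma dyadic_holder_exponent_mono:
  assumes "dyadic_holder \<beta> K N f" "\<alpha> \<le> \<beta>"
  shows "dyadic_holder \<alpha> K N f"
proof -
  have "K * (2 powr - \<beta>) ^ n \<le> K * (2 powr - \<alpha>) ^ n" for n
    using assms(2) dyadic_holder_nonneg[OF assms(1)]
    by (intro mult_left_mono power_mono powr_mono) auto
  then show ?thesis
    using assms(1) unfolding dyadic_holder_def by (meson order_trans)
qed

lemma dyadic_floor_bounds: "dyadic_floor n u \<le> u" "u - dyadic_floor n u \<le> 1 / 2 ^ n"
proof -
  have "real_of_int \<lfloor>2 ^ n * u\<rfloor> \<le> 2 ^ n * u" "2 ^ n * u \<le> real_of_int \<lfloor>2 ^ n * u\<rfloor> + 1"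
    by linarith+
  then have "real_of_int \<lfloor>2 ^ n * u\<rfloor> / 2 ^ n \<le> u" "u \<le> (real_of_int \<lfloor>2 ^ n * u\<rfloor> + 1) / 2 ^ n"
    by (simp_all add: pos_divide_le_eq pos_le_divide_eq mult.commute)
  then show "dyadic_floor n u \<le> u" "u - dyadic_floor n u \<le> 1 / 2 ^ n"
    by (simp_all add: dyadic_floor_def add_divide_distrib)
qed

lemma floor_scaled_bound:
  assumes "\<bar>u\<bar> \<le> real N"
  shows "\<bar>\<lfloor>2 ^ n * u\<rfloor>\<bar> \<le> int N * 2 ^ n"
proof -
  have "2 ^ n * u \<le> 2 ^ n * real N" "2 ^ n * (- real N) \<le> 2 ^ n * u"
    using assms by (intro mult_left_mono; simp; linarith)+
  then have "2 ^ n * u \<le> of_int (int N * 2 ^ n)" "of_int (- (int N * 2 ^ n)) \<le> 2 ^ n * u"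
    by (simp_all add: mult.commute)
  then have "\<lfloor>2 ^ n * u\<rfloor> \<le> int N * 2 ^ n" "- (int N * 2 ^ n) \<le> \<lfloor>2 ^ n * u\<rfloor>"
    by (auto simp only: le_floor_iff) linarith
  then show ?thesis by linarith
qed

lemma dyadic_scale:
  fixes d :: real
  assumes "0 < d" "d \<le> 1"
  obtains n where "2 ^ n * d \<le> 1" "1 / 2 ^ n \<le> 2 * d"
proof -
  define n where "n = nat \<lfloor>- log 2 d\<rfloor>"
  have "0 \<le> - log 2 d" using assms by (simp add: log_le_zero_cancel_iff)
  then have log_bounds: "log 2 d \<le> - real n" "- real (Suc n) < log 2 d"
    unfolding n_def by linarith+
  have "d \<le> 2 powr (- real n)" "2 powr (- real (Suc n)) < d"
    using log_bounds assms by (simp_all add: log_le_iff less_log_iff del: of_nat_Suc)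
  then have "2 ^ n * d \<le> 1" "1 / 2 ^ n \<le> 2 * d"
    by (simp_all add: powr_minus powr_realpow field_simps del: of_nat_Suc)
  then show thesis by (rule that)
qed

lemma geometric_increments_limit:
  fixes a :: "nat \<Rightarrow> 'a::banach"
  assumes "0 \<le> \<rho>" "\<rho> < 1" and step: "\<And>n. norm (a (Suc n) - a n) \<le> K * \<rho> ^ n"
  shows "a \<longlonglongrightarrow> lim a" and "norm (lim a - a n) \<le> K / (1 - \<rho>) * \<rho> ^ n"
proof -
  have "summable (\<lambda>n. a (Suc n) - a n)"
    by (rule summable_comparison_test'[of "\<lambda>n. K * \<rho> ^ n"])
      (use assms in \<open>auto intro!: summable_mult summable_geometric\<close>)
  from summable_LIMSEQ[OF this] have "convergent (\<lambda>n. a n - a 0)"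
    unfolding sum_lessThan_telescope by (auto simp: convergent_def)
  then show a_tendsto: "a \<longlonglongrightarrow> lim a"
    by (simp add: convergent_diff_const_right_iff convergent_LIMSEQ_iff)
  have "(\<lambda>i. a (Suc i + n) - a (i + n)) sums (lim a - a (0 + n))"
    by (intro telescope_sums LIMSEQ_ignore_initial_segment a_tendsto)
  moreover have "(\<lambda>i. K * \<rho> ^ n * \<rho> ^ i) sums (K * \<rho> ^ n * (1 / (1 - \<rho>)))"
    using assms by (intro sums_mult geometric_sums) auto
  ultimately have "norm (lim a - a (0 + n)) \<le> K * \<rho> ^ n * (1 / (1 - \<rho>))"
  proof (rule norm_sums_le)
    show "norm (a (Suc i + n) - a (i + n)) \<le> K * \<rho> ^ n * \<rho> ^ i" for i
      using step[of "i + n"] by (simp add: power_add mult_ac)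
  qed
  then show "norm (lim a - a n) \<le> K / (1 - \<rho>) * \<rho> ^ n" by simp
qed

context
  fixes f :: "real \<Rightarrow> real" and \<alpha> K \<rho> :: real and N :: nat
  assumes exponent_pos: "0 < \<alpha>" and holder: "dyadic_holder \<alpha> K N f"
  defines "\<rho> \<equiv> 2 powr - \<alpha>"
begin

lemma dyadic_ratio_bounds: "0 < \<rho>" "\<rho> < 1"
  using exponent_pos by (auto simp: \<rho>_def powr_less_one)

lemma dyadic_floor_step:
  assumes "\<bar>u\<bar> \<le> real N"
  shows "\<bar>f (dyadic_floor (Suc n) u) - f (dyadic_floor n u)\<bar> \<le> K * \<rho> ^ n"
proof -
  let ?m = "\<lfloor>2 ^ n * u\<rfloor>"
  have "real_of_int ?m \<le> 2 ^ n * u" "2 ^ n * u < real_of_int ?m + 1" by linarith+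
  then have "real_of_int (2 * ?m) \<le> 2 ^ Suc n * u" "2 ^ Suc n * u < real_of_int (2 * ?m + 2)"
    by (simp_all add: algebra_simps)
  then consider (even) "\<lfloor>2 ^ Suc n * u\<rfloor> = 2 * ?m" | (odd) "\<lfloor>2 ^ Suc n * u\<rfloor> = 2 * ?m + 1" by linarith
  then show ?thesis
  proof cases
    case even
    then have "dyadic_floor (Suc n) u = dyadic_floor n u"
      unfolding dyadic_floor_def by simp
    then show ?thesis using dyadic_holder_nonneg[OF holder] dyadic_ratio_bounds by simp
  next
    case odd
    then have "dyadic_floor (Suc n) u = real_of_int (2 * ?m + 1) / 2 ^ Suc n"
      unfolding dyadic_floor_def by simp
    moreover have "dyadic_floor n u = real_of_int (2 * ?m) / 2 ^ Suc n"
      unfolding dyadic_floor_def by simp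
    moreover have "\<bar>2 * ?m\<bar> \<le> int N * 2 ^ Suc n"
      using floor_scaled_bound[OF assms, of n] by simp
    ultimately have "\<bar>f (dyadic_floor (Suc n) u) - f (dyadic_floor n u)\<bar> \<le> K * \<rho> ^ Suc n"
      using dyadic_holderD[OF holder, of "2 * ?m" "Suc n"] by (simp only: \<rho>_def dyadic_increment_def)
    also have "\<dots> \<le> K * \<rho> ^ n"
      using dyadic_holder_nonneg[OF holder] dyadic_ratio_bounds
      by (intro mult_left_mono power_decreasing) auto
    finally show ?thesis .
  qed
qed

lemma dyadic_limit_dist:
  assumes "\<bar>u\<bar> \<le> real N"
  shows "\<bar>dyadic_limit f u - f (dyadic_floor n u)\<bar> \<le> K / (1 - \<rho>) * \<rho> ^ n"
  using geometric_increments_limit(2)[of \<rho> "\<lambda>n. f (dyadic_floor n u)" K n]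
    dyadic_floor_step[OF assms] dyadic_ratio_bounds
  by (simp add: dyadic_limit_def)

lemma dyadic_limit_bounded: "\<exists>B. \<forall>u. \<bar>u\<bar> \<le> real N \<longrightarrow> \<bar>dyadic_limit f u\<bar> \<le> B"
proof (intro exI allI impI)
  fix u assume u_bound: "\<bar>u\<bar> \<le> real N"
  then have "\<lfloor>u\<rfloor> \<in> {- int N..int N}" using floor_scaled_bound[of u N 0] by auto
  then have "\<bar>f (real_of_int \<lfloor>u\<rfloor>)\<bar> \<le> (\<Sum>k\<in>{- int N..int N}. \<bar>f (real_of_int k)\<bar>)"
    by (intro member_le_sum) auto
  then show "\<bar>dyadic_limit f u\<bar> \<le> K / (1 - \<rho>) + (\<Sum>k\<in>{- int N..int N}. \<bar>f (real_of_int k)\<bar>)"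
    using dyadic_limit_dist[OF u_bound, of 0] by (simp add: dyadic_floor_def)
qed

lemma dyadic_limit_holder_close:
  assumes "\<bar>u\<bar> \<le> real N" "\<bar>v\<bar> \<le> real N" "u < v" "v - u \<le> 1"
  shows "\<bar>dyadic_limit f u - dyadic_limit f v\<bar> \<le> (2 * K / (1 - \<rho>) + K) * 2 powr \<alpha> * (v - u) powr \<alpha>"
proof -
  obtain n where scale_bounds: "2 ^ n * (v - u) \<le> 1" "1 / 2 ^ n \<le> 2 * (v - u)"
    using dyadic_scale[of "v - u"] assms by auto
  have "\<rho> ^ n = (1 / 2 ^ n) powr \<alpha>"
    by (simp add: \<rho>_def powr_realpow[symmetric] powr_powr powr_minus_divide[symmetric] mult.commute)
  also have "\<dots> \<le> (2 * (v - u)) powr \<alpha>"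
    using scale_bounds exponent_pos by (intro powr_mono2) auto
  also have "\<dots> = 2 powr \<alpha> * (v - u) powr \<alpha>"
    using assms by (subst powr_mult) auto
  finally have ratio_power_le: "\<rho> ^ n \<le> 2 powr \<alpha> * (v - u) powr \<alpha>" .
  have "2 ^ n * u \<le> 2 ^ n * v" "2 ^ n * v \<le> 2 ^ n * u + 1"
    using assms scale_bounds by (auto simp: algebra_simps)
  then have "\<lfloor>2 ^ n * v\<rfloor> = \<lfloor>2 ^ n * u\<rfloor> \<or> \<lfloor>2 ^ n * v\<rfloor> = \<lfloor>2 ^ n * u\<rfloor> + 1" by linarith
  then have "\<bar>f (dyadic_floor n v) - f (dyadic_floor n u)\<bar> \<le> K * \<rho> ^ n"
    using dyadic_holderD[OF holder floor_scaled_bound[OF assms(1)], of n]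
      dyadic_holder_nonneg[OF holder] dyadic_ratio_bounds
    by (auto simp: dyadic_floor_def dyadic_increment_def \<rho>_def)
  moreover have "(2 * K / (1 - \<rho>) + K) * \<rho> ^ n = 2 * (K / (1 - \<rho>) * \<rho> ^ n) + K * \<rho> ^ n"
    by (simp add: distrib_right)
  ultimately have "\<bar>dyadic_limit f u - dyadic_limit f v\<bar> \<le> (2 * K / (1 - \<rho>) + K) * \<rho> ^ n"
    using dyadic_limit_dist[OF assms(1), of n] dyadic_limit_dist[OF assms(2), of n] by linarith
  also have "\<dots> \<le> (2 * K / (1 - \<rho>) + K) * (2 powr \<alpha> * (v - u) powr \<alpha>)"
    using ratio_power_le dyadic_holder_nonneg[OF holder] dyadic_ratio_bounds by (intro mult_left_mono) auto
  finally show ?thesis by (simp add: mult.assoc)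
qed

lemma dyadic_limit_holder:
  "\<exists>C. \<forall>u v. \<bar>u\<bar> \<le> real N \<longrightarrow> \<bar>v\<bar> \<le> real N \<longrightarrow>
    \<bar>dyadic_limit f u - dyadic_limit f v\<bar> \<le> C * \<bar>u - v\<bar> powr \<alpha>"
proof -
  let ?L = "dyadic_limit f"
  obtain B where L_bound: "\<bar>?L u\<bar> \<le> B" if "\<bar>u\<bar> \<le> real N" for u
    using dyadic_limit_bounded by blast
  define C where "C = (2 * K / (1 - \<rho>) + K) * 2 powr \<alpha>"
  have nonneg: "0 \<le> C" "0 \<le> B"
    using dyadic_holder_nonneg[OF holder] dyadic_ratio_bounds L_bound[of 0] by (auto simp: C_def)
  have ordered: "\<bar>?L u - ?L v\<bar> \<le> (C + 2 * B) * \<bar>u - v\<bar> powr \<alpha>"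
    if "\<bar>u\<bar> \<le> real N" "\<bar>v\<bar> \<le> real N" "u < v" for u v
  proof (cases "v - u \<le> 1")
    case True
    have "\<bar>?L u - ?L v\<bar> \<le> C * \<bar>u - v\<bar> powr \<alpha>"
      using dyadic_limit_holder_close[OF that True] that by (simp add: C_def abs_minus_commute)
    also have "\<dots> \<le> (C + 2 * B) * \<bar>u - v\<bar> powr \<alpha>" using nonneg by (intro mult_right_mono) auto
    finally show ?thesis .
  next
    case False
    have "\<bar>?L u - ?L v\<bar> \<le> 2 * B * 1" using L_bound[of u] L_bound[of v] that by linarith
    also have "\<dots> \<le> (C + 2 * B) * \<bar>u - v\<bar> powr \<alpha>"
      using nonneg False that exponent_pos by (intro mult_mono ge_one_powr_ge_zero) auto
    finally show ?thesis .
  qed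
  have "\<bar>?L u - ?L v\<bar> \<le> (C + 2 * B) * \<bar>u - v\<bar> powr \<alpha>" if "\<bar>u\<bar> \<le> real N" "\<bar>v\<bar> \<le> real N" for u v
    using ordered[of u v] ordered[of v u] that
    by (cases u v rule: linorder_cases) (auto simp: abs_minus_commute)
  then show ?thesis by blast
qed

end

lemma locally_holder_dyadic_limit:
  assumes "0 < \<alpha>" and holder: "\<And>N. \<exists>K. dyadic_holder \<alpha> K N f"
  shows "locally_holder (dyadic_limit f) \<alpha>"
  unfolding locally_holder_def
proof (intro allI)
  fix a b :: real
  obtain N :: nat where "max \<bar>a\<bar> \<bar>b\<bar> \<le> real N" using real_arch_simple by blast
  then have "\<bar>u\<bar> \<le> real N" if "u \<in> {a..b}" for u using that by auto
  moreover obtain K where "dyadic_holder \<alpha> K N f" using holder by blast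
  ultimately show "\<exists>C. \<forall>u\<in>{a..b}. \<forall>v\<in>{a..b}. \<bar>dyadic_limit f u - dyadic_limit f v\<bar> \<le> C * \<bar>u - v\<bar> powr \<alpha>"
    using dyadic_limit_holder[OF \<open>0 < \<alpha>\<close>] by meson
qed

definition dyadic_variation :: "real \<Rightarrow> real \<Rightarrow> nat \<Rightarrow> (real \<Rightarrow> real) \<Rightarrow> nat \<Rightarrow> real" where
  "dyadic_variation \<alpha> p N f n = (\<Sum>k\<in>{- (int N * 2 ^ n)..int N * 2 ^ n}.
    2 powr (n * \<alpha> * p) * \<bar>dyadic_increment f n k\<bar> powr p)"

lemma dyadic_variation_nonneg: "0 \<le> dyadic_variation \<alpha> p N f n"
  unfolding dyadic_variation_def by (intro sum_nonneg) auto

lemma dyadic_holder_if_summable_variation: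
  assumes p_pos: "0 < p" and summable_variation: "summable (dyadic_variation \<alpha> p N f)"
  shows "\<exists>K::nat. dyadic_holder \<alpha> (real K) N f"
proof -
  let ?S = "suminf (dyadic_variation \<alpha> p N f)"
  obtain K :: nat where K_bound: "?S powr (1 / p) \<le> real K"
    using real_arch_simple by blast
  have "\<bar>dyadic_increment f n k\<bar> \<le> real K * (2 powr - \<alpha>) ^ n"
    (is "?D \<le> _") if k_bound: "\<bar>k\<bar> \<le> int N * 2 ^ n" for n k
  proof -
    have "2 powr (n * \<alpha> * p) * ?D powr p \<le> dyadic_variation \<alpha> p N f n"
      unfolding dyadic_variation_def using k_bound
      by (intro member_le_sum[where f="\<lambda>k. 2 powr (n * \<alpha> * p) * \<bar>dyadic_increment f n k\<bar> powr p"]) auto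
    also have "\<dots> \<le> ?S"
      using sum_le_suminf[OF summable_variation, of "{n}"] by (simp add: dyadic_variation_nonneg)
    finally have "(2 powr (n * \<alpha>) * ?D) powr p \<le> ?S"
      by (simp add: powr_mult powr_powr)
    then have "((2 powr (n * \<alpha>) * ?D) powr p) powr (1 / p) \<le> ?S powr (1 / p)"
      using p_pos by (intro powr_mono2) auto
    then have "2 powr (n * \<alpha>) * ?D \<le> real K"
      using K_bound p_pos by (simp add: powr_powr)
    moreover have "(2 powr - \<alpha>) ^ n = 1 / 2 powr (n * \<alpha>)"
      by (subst powr_power) (simp_all add: powr_minus_divide mult.commute)
    ultimately show ?thesis by (simp add: pos_le_divide_eq mult.commute)
  qed
  then show ?thesis unfolding dyadic_holder_def by blast
qed

lemma AE_summable_if_summable_integral: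
  fixes f :: "nat \<Rightarrow> 'a \<Rightarrow> real"
  assumes integrable: "\<And>n. integrable M (f n)" and nonneg: "\<And>n x. 0 \<le> f n x"
    and summable_integral: "summable (\<lambda>n. \<integral>x. f n x \<partial>M)"
  shows "AE x in M. summable (\<lambda>n. f n x)"
proof -
  have [measurable]: "f n \<in> borel_measurable M" for n using integrable by auto
  have "(\<integral>\<^sup>+x. (\<Sum>n. ennreal (f n x)) \<partial>M) = (\<Sum>n. \<integral>\<^sup>+x. ennreal (f n x) \<partial>M)"
    by (rule nn_integral_suminf) simp
  also have "\<dots> = (\<Sum>n. ennreal (\<integral>x. f n x \<partial>M))"
    using integrable nonneg by (simp add: nn_integral_eq_integral)
  also have "\<dots> \<noteq> \<infinity>"
    unfolding infinity_ennreal_def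
    by (intro ennreal_suminf_neq_top summable_integral Bochner_Integration.integral_nonneg nonneg)
  finally have "AE x in M. (\<Sum>n. ennreal (f n x)) \<noteq> \<infinity>"
    by (intro nn_integral_PInf_AE) auto
  then show ?thesis
    by eventually_elim (use nonneg in \<open>auto intro: summable_suminf_not_top\<close>)
qed

locale kolmogorov_increments = prob_space M for M :: "'a measure" +
  fixes Z :: "real \<Rightarrow> 'a \<Rightarrow> real" and p b C :: real
  assumes Z_measurable [measurable]: "\<And>u. random_variable borel (Z u)"
    and p_pos: "0 < p" and b_pos: "0 < b"
    and increment_integrable: "\<And>u v. \<bar>u - v\<bar> \<le> 1 \<Longrightarrow> integrable M (\<lambda>\<omega>. \<bar>Z u \<omega> - Z v \<omega>\<bar> powr p)"
    and increment_moment: "\<And>u v. \<bar>u - v\<bar> \<le> 1 \<Longrightarrow>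
      expectation (\<lambda>\<omega>. \<bar>Z u \<omega> - Z v \<omega>\<bar> powr p) \<le> C * \<bar>u - v\<bar> powr (1 + b)"
begin

lemma moment_constant_nonneg: "0 \<le> C"
proof -
  have "0 \<le> expectation (\<lambda>\<omega>. \<bar>Z 1 \<omega> - Z 0 \<omega>\<bar> powr p)"
    by (rule Bochner_Integration.integral_nonneg) simp
  also have "\<dots> \<le> C" using increment_moment[of 1 0] by simp
  finally show ?thesis .
qed

lemma AE_tendsto_dyadic_floor: "AE \<omega> in M. (\<lambda>n. Z (dyadic_floor n u) \<omega>) \<longlonglongrightarrow> Z u \<omega>"
proof -
  define D where "D n \<omega> = \<bar>Z (dyadic_floor n u) \<omega> - Z u \<omega>\<bar>" for n \<omega>
  have dist: "\<bar>dyadic_floor n u - u\<bar> \<le> 1 / 2 ^ n" "\<bar>dyadic_floor n u - u\<bar> \<le> 1" for n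
  proof -
    show "\<bar>dyadic_floor n u - u\<bar> \<le> 1 / 2 ^ n"
      using dyadic_floor_bounds[where n=n and u=u] by simp
    also have "\<dots> \<le> 1" by simp
    finally show "\<bar>dyadic_floor n u - u\<bar> \<le> 1" .
  qed
  have moment: "expectation (\<lambda>\<omega>. D n \<omega> powr p) \<le> C * (1 / 2) ^ n" for n
  proof -
    have "\<bar>dyadic_floor n u - u\<bar> powr (1 + b) \<le> \<bar>dyadic_floor n u - u\<bar>"
      using dist(2)[of n] b_pos powr_mono'[of 1 "1 + b" "\<bar>dyadic_floor n u - u\<bar>"] by simp
    then have "\<bar>dyadic_floor n u - u\<bar> powr (1 + b) \<le> (1 / 2) ^ n"
      using dist(1)[of n] by (simp add: power_divide)
    from mult_left_mono[OF this moment_constant_nonneg] show ?thesis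
      using increment_moment[OF dist(2), of n] unfolding D_def by linarith
  qed
  have "AE \<omega> in M. summable (\<lambda>n. D n \<omega> powr p)"
  proof (rule AE_summable_if_summable_integral)
    show "summable (\<lambda>n. expectation (\<lambda>\<omega>. D n \<omega> powr p))"
      by (rule summable_comparison_test'[of "\<lambda>n. C * (1 / 2) ^ n"])
        (use moment in \<open>auto intro!: summable_mult summable_geometric\<close>)
  qed (use increment_integrable[OF dist(2)] in \<open>auto simp: D_def\<close>)
  then show ?thesis
  proof eventually_elim
    case (elim \<omega>)
    have "(\<lambda>n. (D n \<omega> powr p) powr (1 / p)) \<longlonglongrightarrow> 0"
      using tendsto_zero_powrI[OF summable_LIMSEQ_zero[OF elim] tendsto_const[of "1 / p"]] p_pos by simp
    then have "(\<lambda>n. D n \<omega>) \<longlonglongrightarrow> 0"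
      using p_pos by (simp add: powr_powr D_def)
    then show ?case
      by (simp add: D_def tendsto_rabs_zero_iff LIM_zero_iff)
  qed
qed

lemma dyadic_increment_moment:
  "integrable M (\<lambda>\<omega>. \<bar>dyadic_increment (\<lambda>u. Z u \<omega>) n k\<bar> powr p)"
  "expectation (\<lambda>\<omega>. \<bar>dyadic_increment (\<lambda>u. Z u \<omega>) n k\<bar> powr p)
    \<le> C * 2 powr (- real n * (1 + b))"
proof -
  have mesh: "\<bar>real_of_int (k + 1) / 2 ^ n - real_of_int k / 2 ^ n\<bar> = 2 powr - real n"
    by (simp add: diff_divide_distrib[symmetric] powr_minus powr_realpow inverse_eq_divide)
  have "\<bar>real_of_int (k + 1) / 2 ^ n - real_of_int k / 2 ^ n\<bar> \<le> 1"
    unfolding mesh using powr_mono[of "- real n" 0 2] by simp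
  from increment_integrable[OF this] increment_moment[OF this]
  show "integrable M (\<lambda>\<omega>. \<bar>dyadic_increment (\<lambda>u. Z u \<omega>) n k\<bar> powr p)"
    "expectation (\<lambda>\<omega>. \<bar>dyadic_increment (\<lambda>u. Z u \<omega>) n k\<bar> powr p)
      \<le> C * 2 powr (- real n * (1 + b))"
    unfolding mesh powr_powr dyadic_increment_def by this+
qed

lemma dyadic_variation_integrable: "integrable M (\<lambda>\<omega>. dyadic_variation \<alpha> p N (\<lambda>u. Z u \<omega>) n)"
  unfolding dyadic_variation_def using dyadic_increment_moment(1)
  by (intro Bochner_Integration.integrable_sum integrable_mult_right)

lemma dyadic_variation_moment:
  "expectation (\<lambda>\<omega>. dyadic_variation \<alpha> p N (\<lambda>u. Z u \<omega>) n) \<le> (2 * real N + 1) * C * (2 powr (\<alpha> * p - b)) ^ n"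
proof -
  define A where "A = {- (int N * 2 ^ n)..int N * 2 ^ n}"
  have "real (card A) = 2 * real N * 2 ^ n + 1" by (simp add: A_def)
  also have "\<dots> \<le> (2 * real N + 1) * 2 powr n" by (simp add: powr_realpow algebra_simps)
  finally have card: "real (card A) \<le> (2 * real N + 1) * 2 powr n" .
  have "expectation (\<lambda>\<omega>. dyadic_variation \<alpha> p N (\<lambda>u. Z u \<omega>) n) = (\<Sum>k\<in>A. 2 powr (n * \<alpha> * p) *
      expectation (\<lambda>\<omega>. \<bar>dyadic_increment (\<lambda>u. Z u \<omega>) n k\<bar> powr p))"
    unfolding dyadic_variation_def A_def[symmetric]
    by (subst Bochner_Integration.integral_sum)
      (intro integrable_mult_right dyadic_increment_moment(1), simp only: integral_mult_right_zero)
  also have "\<dots> \<le> (\<Sum>k\<in>A. 2 powr (n * \<alpha> * p) * (C * 2 powr (- real n * (1 + b))))"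
    by (intro sum_mono mult_left_mono dyadic_increment_moment(2)) simp
  also have "\<dots> = real (card A) * (C * 2 powr (n * \<alpha> * p - n * (1 + b)))"
    by (simp add: powr_diff powr_minus divide_inverse mult_ac)
  also have "\<dots> \<le> (2 * real N + 1) * 2 powr n * (C * 2 powr (n * \<alpha> * p - n * (1 + b)))"
    using moment_constant_nonneg by (intro mult_right_mono card) auto
  also have "\<dots> = (2 * real N + 1) * C * (2 powr n * 2 powr (n * \<alpha> * p - n * (1 + b)))"
    by (simp only: mult_ac)
  also have "2 powr n * 2 powr (n * \<alpha> * p - n * (1 + b)) = (2 powr (\<alpha> * p - b)) ^ n"
    by (simp add: powr_power algebra_simps flip: powr_add)
  finally show ?thesis .
qed

lemma AE_dyadic_holder:
  assumes "\<alpha> * p < b"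
  shows "AE \<omega> in M. \<exists>K::nat. dyadic_holder \<alpha> (real K) N (\<lambda>u. Z u \<omega>)"
proof -
  have "AE \<omega> in M. summable (dyadic_variation \<alpha> p N (\<lambda>u. Z u \<omega>))"
  proof (rule AE_summable_if_summable_integral)
    have nonneg: "0 \<le> expectation (\<lambda>\<omega>. dyadic_variation \<alpha> p N (\<lambda>u. Z u \<omega>) n)" for n
      by (intro Bochner_Integration.integral_nonneg dyadic_variation_nonneg)
    have "summable (\<lambda>n. (2 * real N + 1) * C * (2 powr (\<alpha> * p - b)) ^ n)"
      using assms by (intro summable_mult summable_geometric) (auto simp: powr_less_one)
    then show "summable (\<lambda>n. expectation (\<lambda>\<omega>. dyadic_variation \<alpha> p N (\<lambda>u. Z u \<omega>) n))"
      by (rule summable_comparison_test')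
        (simp only: real_norm_def abs_of_nonneg[OF nonneg] dyadic_variation_moment)
  qed (rule dyadic_variation_integrable dyadic_variation_nonneg)+
  then show ?thesis
    by eventually_elim (rule dyadic_holder_if_summable_variation[OF p_pos])
qed

end

theorem (in prob_space) kolmogorov_chentsov:
  fixes Z :: "real \<Rightarrow> 'a \<Rightarrow> real"
  assumes "0 < \<gamma>"
    and increments: "\<And>\<alpha>. 0 < \<alpha> \<Longrightarrow> \<alpha> < \<gamma> \<Longrightarrow> \<exists>p b C. kolmogorov_increments M Z p b C \<and> \<alpha> * p < b"
  shows "\<exists>Z'. (\<forall>u. random_variable borel (Z' u) \<and> (AE \<omega> in M. Z' u \<omega> = Z u \<omega>)) \<and>
    (\<forall>\<omega>\<in>space M. \<forall>\<alpha>. 0 < \<alpha> \<and> \<alpha> < \<gamma> \<longrightarrow> locally_holder (\<lambda>u. Z' u \<omega>) \<alpha>)"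
proof -
  \<comment> \<open>rational exponents and natural constants, so that the event is measurable\<close>
  let ?exponents = "{q. 0 < real_of_rat q \<and> real_of_rat q < \<gamma>}"
  define good where "good \<omega> \<longleftrightarrow>
    (\<forall>q\<in>?exponents. \<forall>N. \<exists>K::nat. dyadic_holder (real_of_rat q) (real K) N (\<lambda>u. Z u \<omega>))" for \<omega>
  define Z' where "Z' u \<omega> = (if good \<omega> then dyadic_limit (\<lambda>u. Z u \<omega>) u else 0)" for u \<omega>
  obtain p b C where "kolmogorov_increments M Z p b C"
    using increments[of "\<gamma> / 2"] \<open>0 < \<gamma>\<close> by auto
  then interpret kolmogorov_increments M Z p b C .
  have [measurable]: "Measurable.pred M good"
    unfolding good_def dyadic_holder_def dyadic_increment_def by measurable
  have "AE \<omega> in M. \<exists>K::nat. dyadic_holder (real_of_rat q) (real K) N (\<lambda>u. Z u \<omega>)"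
    if "q \<in> ?exponents" for q N
    using that increments kolmogorov_increments.AE_dyadic_holder by blast
  then have AE_good: "AE \<omega> in M. good \<omega>"
    unfolding good_def by (simp add: AE_ball_countable AE_all_countable)
  have "AE \<omega> in M. Z' u \<omega> = Z u \<omega>" for u
    using AE_tendsto_dyadic_floor[of u] AE_good
    by eventually_elim (auto simp: Z'_def dyadic_limit_def intro: limI)
  moreover have "random_variable borel (Z' u)" for u
    unfolding Z'_def dyadic_limit_def by measurable
  moreover have "locally_holder (\<lambda>u. Z' u \<omega>) \<alpha>" if "0 < \<alpha>" "\<alpha> < \<gamma>" for \<omega> \<alpha>
  proof (cases "good \<omega>")
    case True
    obtain q where "\<alpha> < real_of_rat q" "real_of_rat q < \<gamma>"
      using of_rat_dense[OF \<open>\<alpha> < \<gamma>\<close>] by blast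
    then have "\<exists>K. dyadic_holder \<alpha> K N (\<lambda>u. Z u \<omega>)" for N
      using True \<open>0 < \<alpha>\<close> dyadic_holder_exponent_mono[of "real_of_rat q" _ N _ \<alpha>]
      unfolding good_def by fastforce
    then have "locally_holder (dyadic_limit (\<lambda>u. Z u \<omega>)) \<alpha>"
      using \<open>0 < \<alpha>\<close> by (intro locally_holder_dyadic_limit)
    then show ?thesis using True by (simp add: Z'_def[abs_def])
  next
    case False
    then show ?thesis by (auto simp: Z'_def locally_holder_def intro!: exI[of _ 0])
  qed
  ultimately show ?thesis by blast
qed

theorem (in prob_space) gaussian_holder_version:
  fixes Z :: "real \<Rightarrow> 'a \<Rightarrow> real"
  assumes gaussian: "centered_gaussian_family M UNIV Z" and "0 < H"
    and variance: "\<And>u v. \<bar>u - v\<bar> \<le> 1 \<Longrightarrow> expectation (\<lambda>\<omega>. (Z u \<omega> - Z v \<omega>)\<^sup>2) \<le> C * \<bar>u - v\<bar> powr (2 * H)"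
  shows "\<exists>Z'. (\<forall>u. random_variable borel (Z' u) \<and> (AE \<omega> in M. Z' u \<omega> = Z u \<omega>)) \<and>
    (\<forall>\<omega>\<in>space M. \<forall>\<alpha>. 0 < \<alpha> \<and> \<alpha> < H \<longrightarrow> locally_holder (\<lambda>u. Z' u \<omega>) \<alpha>)"
proof (rule kolmogorov_chentsov[OF \<open>0 < H\<close>])
  fix \<alpha> assume "0 < \<alpha>" "\<alpha> < H"
  obtain m :: nat where m_large: "1 < real m * (2 * H - 2 * \<alpha>)"
    using ex_less_of_nat_mult[of "2 * H - 2 * \<alpha>" 1] \<open>\<alpha> < H\<close> by auto
  then have "m \<noteq> 0" by (cases m) auto
  define a :: real where "a = fact (2 * m) / (2 ^ m * fact m)"
  have exponent: "\<alpha> * real (2 * m) < 2 * H * m - 1"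
    using m_large by (simp add: algebra_simps)
  moreover have "kolmogorov_increments M Z (real (2 * m)) (2 * H * m - 1) (a * C ^ m)"
  proof
    show "random_variable borel (Z u)" for u
      using gaussian by (simp add: centered_gaussian_family_def)
    show "0 < real (2 * m)" using \<open>m \<noteq> 0\<close> by simp
    then show "0 < 2 * H * m - 1"
      using exponent \<open>0 < \<alpha>\<close> mult_pos_pos[of \<alpha> "real (2 * m)"] by linarith
    fix u v :: real assume uv_close: "\<bar>u - v\<bar> \<le> 1"
    let ?s = "expectation (\<lambda>\<omega>. (Z u \<omega> - Z v \<omega>)\<^sup>2)"
    have even_power: "\<bar>x\<bar> powr real (2 * m) = x ^ (2 * m)" for x :: real
      using \<open>m \<noteq> 0\<close> by (subst powr_realpow') (auto simp: power_mult)
    have moment: "has_bochner_integral M (\<lambda>\<omega>. \<bar>Z u \<omega> - Z v \<omega>\<bar> powr real (2 * m)) (a * ?s ^ m)"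
      unfolding even_power a_def
      by (intro has_bochner_integral_centered_normal_even centered_normal_increment[OF gaussian]) auto
    then show "integrable M (\<lambda>\<omega>. \<bar>Z u \<omega> - Z v \<omega>\<bar> powr real (2 * m))"
      by (simp add: has_bochner_integral_iff)
    have "a * ?s ^ m \<le> a * (C * \<bar>u - v\<bar> powr (2 * H)) ^ m"
      using variance[OF uv_close] by (intro mult_left_mono power_mono) (auto simp: a_def)
    also have "\<dots> = a * C ^ m * \<bar>u - v\<bar> powr (1 + (2 * H * m - 1))"
      using \<open>m \<noteq> 0\<close> by (cases "u = v") (simp_all add: power_mult_distrib powr_power mult_ac)
    finally show "expectation (\<lambda>\<omega>. \<bar>Z u \<omega> - Z v \<omega>\<bar> powr real (2 * m)) \<le>
        a * C ^ m * \<bar>u - v\<bar> powr (1 + (2 * H * m - 1))"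
      using moment by (simp add: has_bochner_integral_iff)
  qed
  ultimately show "\<exists>p b C. kolmogorov_increments M Z p b C \<and> \<alpha> * p < b" by blast
qed

section \<open>The Poisson process driven by uniform variables\<close>

definition poisson_event :: "nat \<Rightarrow> real \<Rightarrow> (nat \<Rightarrow> real) set" where
  "poisson_event k t = {y. (\<Prod>i<k+1. y i) < exp (- t) \<and> exp (- t) < (\<Prod>i<k. y i)}"

lemma (in sequence_space) nn_integral_case_nat:
  assumes [measurable]: "f \<in> borel_measurable S"
  shows "(\<integral>\<^sup>+\<omega>. f \<omega> \<partial>S) = (\<integral>\<^sup>+x. \<integral>\<^sup>+\<omega>. f (case_nat x \<omega>) \<partial>S \<partial>M)"
proof -
  have "(\<integral>\<^sup>+\<omega>. f \<omega> \<partial>S) = (\<integral>\<^sup>+\<omega>. f \<omega> \<partial>distr (M \<Otimes>\<^sub>M S) S (\<lambda>(x, \<omega>). case_nat x \<omega>))"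
    by (simp only: PiM_iter)
  also have "\<dots> = (\<integral>\<^sup>+z. f (case_nat (fst z) (snd z)) \<partial>(M \<Otimes>\<^sub>M S))"
    by (subst nn_integral_distr) (auto simp: split_beta')
  also have "\<dots> = (\<integral>\<^sup>+x. \<integral>\<^sup>+\<omega>. f (case_nat x \<omega>) \<partial>S \<partial>M)"
    by (subst nn_integral_fst[symmetric]) auto
  finally show ?thesis .
qed

abbreviation unif01 :: "real measure" where
  "unif01 \<equiv> uniform_measure lborel {0..1}"

lemma prob_space_unif01: "prob_space unif01"
  by (rule prob_space_uniform_measure) auto

interpretation unif_seq: sequence_space unif01
proof -
  interpret prob_space unif01 by (rule prob_space_unif01)
  show "sequence_space unif01" by unfold_locales
qed

interpretation P_unif: prob_space P_unif
  unfolding P_unif_def by (rule unif_seq.prob_space_axioms)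

lemma space_P_unif [simp]: "space P_unif = UNIV"
  unfolding P_unif_def by (simp add: space_PiM)

lemma measurable_P_unif_component: "(\<lambda>y. y i) \<in> borel_measurable P_unif"
  using measurable_component_singleton[of i UNIV "\<lambda>_. unif01"]
  unfolding P_unif_def by (simp add: measurable_cong_sets[OF refl, of unif01 borel])

lemma poisson_event_measurable [measurable]: "poisson_event k t \<in> sets P_unif"
proof -
  note [measurable] = measurable_P_unif_component
  have "{y \<in> space P_unif. (\<Prod>i<k+1. y i) < exp (- t) \<and> exp (- t) < (\<Prod>i<k. y i)} \<in> sets P_unif"
    by measurable
  then show ?thesis by (simp add: poisson_event_def)
qed

lemma AE_P_unif_prod_le_1: "AE y in P_unif. \<forall>k. (\<Prod>i<k. y i) \<le> 1"
proof -
  have "AE y in P_unif. 0 \<le> y i \<and> y i \<le> 1" for i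
    unfolding P_unif_def
    by (rule AE_PiM_component[where P="\<lambda>y. 0 \<le> y \<and> y \<le> 1"])
      (auto intro: prob_space_unif01 AE_uniform_measureI)
  then have "AE y in P_unif. \<forall>i. 0 \<le> y i \<and> y i \<le> 1"
    by (subst AE_all_countable) auto
  then show ?thesis
    by eventually_elim (auto intro!: prod_le_1)
qed

lemma emeasure_P_unif_case_nat:
  assumes "A \<in> sets P_unif"
  shows "emeasure P_unif A = (\<integral>\<^sup>+y. emeasure P_unif {\<omega>. case_nat y \<omega> \<in> A} * indicator {0..1} y \<partial>lborel)"
proof -
  have A_measurable[measurable]: "A \<in> sets unif_seq.S" using assms by (simp add: P_unif_def)
  have slice: "(\<integral>\<^sup>+\<omega>. indicator A (case_nat y \<omega>) \<partial>unif_seq.S) = emeasure P_unif {\<omega>. case_nat y \<omega> \<in> A}" for y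
  proof -
    have "(\<lambda>\<omega>. case_nat y \<omega>) -` A \<inter> space unif_seq.S \<in> sets unif_seq.S"
      by (rule measurable_sets[OF _ A_measurable]) simp
    then have "{\<omega>. case_nat y \<omega> \<in> A} \<in> sets unif_seq.S" by (simp add: vimage_def space_PiM)
    then show ?thesis
      by (simp add: P_unif_def nn_integral_indicator[symmetric] indicator_def del: nn_integral_indicator)
  qed
  have "(\<lambda>y. \<integral>\<^sup>+\<omega>. indicator A (case_nat y \<omega>) \<partial>unif_seq.S) \<in> borel_measurable unif01"
    by measurable
  then have [measurable]: "(\<lambda>y. emeasure P_unif {\<omega>. case_nat y \<omega> \<in> A}) \<in> borel_measurable lborel"
    unfolding slice by (simp add: measurable_cong_sets[of unif01 lborel])
  have "emeasure P_unif A = (\<integral>\<^sup>+\<omega>. indicator A \<omega> \<partial>unif_seq.S)"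
    by (simp add: P_unif_def)
  also have "\<dots> = (\<integral>\<^sup>+y. emeasure P_unif {\<omega>. case_nat y \<omega> \<in> A} \<partial>unif01)"
    by (subst unif_seq.nn_integral_case_nat) (simp_all add: slice)
  also have "\<dots> = (\<integral>\<^sup>+y. emeasure P_unif {\<omega>. case_nat y \<omega> \<in> A} * indicator {0..1} y \<partial>lborel)"
    by (subst nn_integral_uniform_measure) (auto simp: divide_ennreal_def)
  finally show ?thesis .
qed

lemma case_nat_in_poisson_event_0:
  "0 < t \<Longrightarrow> case_nat y \<omega> \<in> poisson_event 0 t \<longleftrightarrow> y < exp (- t)"
  by (simp add: poisson_event_def)

lemma case_nat_in_poisson_event_Suc:
  assumes "0 < y"
  shows "case_nat y \<omega> \<in> poisson_event (Suc k) t \<longleftrightarrow> \<omega> \<in> poisson_event k (t + ln y)"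
proof -
  have "exp (- (t + ln y)) = exp (- t) / y" using assms by (simp add: exp_diff)
  then show ?thesis using assms
    by (simp add: poisson_event_def prod.lessThan_Suc_shift pos_less_divide_eq pos_divide_less_eq
        mult.commute[of y] del: prod.lessThan_Suc minus_add_distrib)
qed

lemma AE_case_nat_notin_poisson_event_Suc:
  assumes "0 \<le> y" "y \<le> exp (- t)"
  shows "AE \<omega> in P_unif. case_nat y \<omega> \<notin> poisson_event (Suc k) t"
  using AE_P_unif_prod_le_1
proof eventually_elim
  case (elim \<omega>)
  have "y * (\<Prod>i<k. \<omega> i) \<le> y * 1"
    using elim assms by (intro mult_left_mono) auto
  then show ?case using assms
    by (simp add: poisson_event_def prod.lessThan_Suc_shift del: prod.lessThan_Suc)
qed

lemma emeasure_poisson_event_Suc: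
  assumes "0 < t" and [measurable]: "A \<in> sets P_unif"
  shows "emeasure P_unif (poisson_event (Suc k) t \<inter> A) =
    (\<integral>\<^sup>+y. emeasure P_unif (poisson_event k (t + ln y) \<inter> {\<omega>. case_nat y \<omega> \<in> A}) *
      indicator {exp (- t)<..<1} y \<partial>lborel)"
proof -
  let ?E = "\<lambda>y. {\<omega>. case_nat y \<omega> \<in> poisson_event (Suc k) t \<inter> A}"
  have "emeasure P_unif (poisson_event (Suc k) t \<inter> A) =
      (\<integral>\<^sup>+y. emeasure P_unif (?E y) * indicator {0..1} y \<partial>lborel)"
    by (rule emeasure_P_unif_case_nat) measurable
  also have "\<dots> = (\<integral>\<^sup>+y. emeasure P_unif (poisson_event k (t + ln y) \<inter> {\<omega>. case_nat y \<omega> \<in> A}) *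
      indicator {exp (- t)<..<1} y \<partial>lborel)"
  proof (intro nn_integral_cong_AE eventually_mono[OF AE_lborel_singleton])
    fix y :: real assume "y \<noteq> 1"
    consider (outside) "y < 0 \<or> 1 < y" | (below) "0 \<le> y" "y \<le> exp (- t)" | (above) "exp (- t) < y" "y < 1"
      using \<open>y \<noteq> 1\<close> by linarith
    then show "emeasure P_unif (?E y) * indicator {0..1} y =
        emeasure P_unif (poisson_event k (t + ln y) \<inter> {\<omega>. case_nat y \<omega> \<in> A}) * indicator {exp (- t)<..<1} y"
    proof cases
      case outside
      then have "\<not> exp (- t) < y \<or> \<not> y < 1" using exp_gt_zero[of "- t"] by linarith
      with outside show ?thesis by auto
    next
      case below
      have "AE \<omega> in P_unif. case_nat y \<omega> \<notin> poisson_event (Suc k) t \<inter> A"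
        using AE_case_nat_notin_poisson_event_Suc[OF below, of k] by eventually_elim simp
      from emeasure_eq_0_AE[OF this] show ?thesis using below by simp
    next
      case above
      then have "0 < y" using exp_gt_zero[of "- t"] by linarith
      then have "?E y = poisson_event k (t + ln y) \<inter> {\<omega>. case_nat y \<omega> \<in> A}"
        by (auto simp: case_nat_in_poisson_event_Suc)
      then show ?thesis using above \<open>0 < y\<close> by simp
    qed
  qed
  finally show ?thesis .
qed

lemma psi_nonneg: "0 \<le> t \<Longrightarrow> 0 \<le> psi k t"
  by (simp add: psi_def)

lemma borel_measurable_psi [measurable]: "psi k \<in> borel_measurable borel"
  unfolding psi_def[abs_def] by measurable

lemma nn_integral_psi_ln:
  assumes "s \<le> t"
  shows "(\<integral>\<^sup>+y. ennreal (psi k (t + ln y)) * indicator {exp (- t)<..<exp (- s)} y \<partial>lborel) =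
    ennreal (exp (- s) * psi (Suc k) (t - s))"
proof -
  define F where "F y = exp (- t) * (t + ln y) ^ Suc k / fact (Suc k)" for y
  have add_ln_nonneg: "0 < y" "0 \<le> t + ln y" if "exp (- t) \<le> y" for y
  proof -
    show "0 < y" using that exp_gt_zero[of "- t"] by linarith
    then have "- t \<le> ln y" using that by (simp add: ln_ge_iff)
    then show "0 \<le> t + ln y" by simp
  qed
  have deriv: "(F has_real_derivative psi k (t + ln y)) (at y)" if "exp (- t) \<le> y" for y
  proof -
    have "(F has_real_derivative exp (- t) * (real (Suc k) * (t + ln y) ^ k * (1 / y)) / fact (Suc k)) (at y)"
      unfolding F_def using add_ln_nonneg(1)[OF that]
      by (auto intro!: derivative_eq_intros simp del: power_Suc of_nat_Suc fact_Suc)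
    also have "exp (- t) * (real (Suc k) * (t + ln y) ^ k * (1 / y)) / fact (Suc k) = psi k (t + ln y)"
    proof -
      have "exp (- (t + ln y)) = exp (- t) / y" using add_ln_nonneg(1)[OF that] by (simp add: exp_diff)
      then show ?thesis unfolding psi_def by (simp add: field_simps del: minus_add_distrib of_nat_Suc)
    qed
    finally show ?thesis .
  qed
  have "(\<integral>\<^sup>+y. ennreal (psi k (t + ln y)) * indicator {exp (- t)<..<exp (- s)} y \<partial>lborel) =
      (\<integral>\<^sup>+y. ennreal (psi k (t + ln y)) * indicator {exp (- t)..exp (- s)} y \<partial>lborel)"
  proof (rule nn_integral_cong_AE)
    have "AE y in lborel. y \<noteq> exp (- t)" "AE y in lborel. y \<noteq> exp (- s)"
      by (rule AE_lborel_singleton)+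
    then show "AE y in lborel. ennreal (psi k (t + ln y)) * indicator {exp (- t)<..<exp (- s)} y =
        ennreal (psi k (t + ln y)) * indicator {exp (- t)..exp (- s)} y"
      by eventually_elim (auto simp: indicator_def)
  qed
  also have "\<dots> = ennreal (F (exp (- s)) - F (exp (- t)))"
    using assms add_ln_nonneg by (intro nn_integral_FTC_Icc deriv) (auto intro: psi_nonneg)
  also have "F (exp (- s)) - F (exp (- t)) = exp (- s) * psi (Suc k) (t - s)"
    by (simp add: F_def psi_def flip: exp_add)
  finally show ?thesis .
qed

definition poisson_joint :: "nat \<Rightarrow> nat \<Rightarrow> real \<Rightarrow> real \<Rightarrow> real" where
  "poisson_joint i j s t = (if i \<le> j then psi i s * psi (j - i) (t - s) else 0)"

lemma poisson_joint_nonneg: "0 \<le> s \<Longrightarrow> s \<le> t \<Longrightarrow> 0 \<le> poisson_joint i j s t"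
  by (simp add: poisson_joint_def psi_nonneg)

lemma poisson_joint_same: "poisson_joint k k t t = psi k t"
  by (simp add: poisson_joint_def psi_def)

lemma emeasure_poisson_event_0_0:
  assumes "0 < s" "s \<le> t"
  shows "emeasure P_unif (poisson_event 0 s \<inter> poisson_event 0 t) = ennreal (poisson_joint 0 0 s t)"
proof -
  have "emeasure P_unif (poisson_event 0 s \<inter> poisson_event 0 t) =
      (\<integral>\<^sup>+y. emeasure P_unif {\<omega>. case_nat y \<omega> \<in> poisson_event 0 s \<inter> poisson_event 0 t} *
        indicator {0..1} y \<partial>lborel)"
    by (rule emeasure_P_unif_case_nat) measurable
  also have "\<dots> = (\<integral>\<^sup>+y. indicator {0..<exp (- t)} y \<partial>lborel)"
  proof (intro nn_integral_cong)
    fix y :: real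
    have "exp (- t) \<le> exp (- s)" "exp (- s) < 1" using assms by simp_all
    then have "y < exp (- s)" "y \<le> 1" if "y < exp (- t)" using that by linarith+
    then show "emeasure P_unif {\<omega>. case_nat y \<omega> \<in> poisson_event 0 s \<inter> poisson_event 0 t} *
        indicator {0..1} y = indicator {0..<exp (- t)} y"
      using assms P_unif.emeasure_space_1 by (auto simp: case_nat_in_poisson_event_0 indicator_def)
  qed
  also have "\<dots> = ennreal (poisson_joint 0 0 s t)"
    by (simp add: poisson_joint_def psi_def flip: exp_add)
  finally show ?thesis .
qed

lemma emeasure_poisson_event_Suc_0:
  assumes "0 < s" "s \<le> t"
  shows "emeasure P_unif (poisson_event (Suc i) s \<inter> poisson_event 0 t) = 0"
proof -
  have empty: "\<not> x < exp (- t)" if "exp (- s) < x" for x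
  proof -
    have "exp (- t) \<le> exp (- s)" using assms by simp
    then show ?thesis using that by linarith
  qed
  have "(\<integral>\<^sup>+y. emeasure P_unif (poisson_event i (s + ln y) \<inter> {\<omega>. case_nat y \<omega> \<in> poisson_event 0 t}) *
      indicator {exp (- s)<..<1} y \<partial>lborel) = (\<integral>\<^sup>+y. 0 \<partial>(lborel :: real measure))"
    using assms by (intro nn_integral_cong) (auto simp: case_nat_in_poisson_event_0 indicator_def dest: empty)
  then show ?thesis using assms by (simp add: emeasure_poisson_event_Suc)
qed

lemma add_ln_pos:
  assumes "exp (- t) < (y::real)"
  shows "0 < y" "0 < t + ln y"
proof -
  show "0 < y" using assms exp_gt_zero[of "- t"] by linarith
  then have "- t < ln y" using assms ln_less_cancel_iff[of "exp (- t)" y] by simp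
  then show "0 < t + ln y" by simp
qed

lemma emeasure_poisson_event_0_Suc:
  assumes s_le_t: "0 < s" "s \<le> t"
    and marginal: "\<And>\<tau>. 0 < \<tau> \<Longrightarrow> emeasure P_unif (poisson_event k \<tau>) = ennreal (psi k \<tau>)"
  shows "emeasure P_unif (poisson_event 0 s \<inter> poisson_event (Suc k) t) = ennreal (poisson_joint 0 (Suc k) s t)"
proof -
  have "emeasure P_unif (poisson_event 0 s \<inter> poisson_event (Suc k) t) =
      (\<integral>\<^sup>+y. emeasure P_unif (poisson_event k (t + ln y) \<inter> {\<omega>. case_nat y \<omega> \<in> poisson_event 0 s}) *
        indicator {exp (- t)<..<1} y \<partial>lborel)"
    using s_le_t by (subst Int_commute, intro emeasure_poisson_event_Suc) auto
  also have "\<dots> = (\<integral>\<^sup>+y. ennreal (psi k (t + ln y)) * indicator {exp (- t)<..<exp (- s)} y \<partial>lborel)"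
  proof (intro nn_integral_cong)
    fix y :: real
    have "exp (- s) < 1" using s_le_t by simp
    then have "y < 1" if "y < exp (- s)" using that by linarith
    then show "emeasure P_unif (poisson_event k (t + ln y) \<inter> {\<omega>. case_nat y \<omega> \<in> poisson_event 0 s}) *
        indicator {exp (- t)<..<1} y = ennreal (psi k (t + ln y)) * indicator {exp (- t)<..<exp (- s)} y"
      using s_le_t marginal[OF add_ln_pos(2)] by (auto simp: case_nat_in_poisson_event_0 indicator_def)
  qed
  also have "\<dots> = ennreal (poisson_joint 0 (Suc k) s t)"
    using s_le_t by (subst nn_integral_psi_ln) (auto simp: poisson_joint_def psi_def[of 0])
  finally show ?thesis .
qed

lemma emeasure_poisson_event_Suc_Suc:
  assumes s_le_t: "0 < s" "s \<le> t"
    and joint: "\<And>\<sigma> \<tau>. 0 < \<sigma> \<Longrightarrow> \<sigma> \<le> \<tau> \<Longrightarrow>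
      emeasure P_unif (poisson_event m \<sigma> \<inter> poisson_event k \<tau>) = ennreal (poisson_joint m k \<sigma> \<tau>)"
  shows "emeasure P_unif (poisson_event (Suc m) s \<inter> poisson_event (Suc k) t) =
    ennreal (poisson_joint (Suc m) (Suc k) s t)"
proof -
  let ?c = "if m \<le> k then psi (k - m) (t - s) else 0"
  have factor: "0 \<le> ?c" "poisson_joint m k (s + x) (t + x) = ?c * psi m (s + x)" for x
    using s_le_t by (simp_all add: poisson_joint_def psi_nonneg)
  have "emeasure P_unif (poisson_event (Suc m) s \<inter> poisson_event (Suc k) t) =
      (\<integral>\<^sup>+y. emeasure P_unif (poisson_event m (s + ln y) \<inter> {\<omega>. case_nat y \<omega> \<in> poisson_event (Suc k) t}) *
        indicator {exp (- s)<..<1} y \<partial>lborel)"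
    using s_le_t by (intro emeasure_poisson_event_Suc) auto
  also have "\<dots> = (\<integral>\<^sup>+y. ennreal ?c *
      (ennreal (psi m (s + ln y)) * indicator {exp (- s)<..<exp (- 0)} y) \<partial>lborel)"
  proof (intro nn_integral_cong)
    fix y :: real
    show "emeasure P_unif (poisson_event m (s + ln y) \<inter> {\<omega>. case_nat y \<omega> \<in> poisson_event (Suc k) t}) *
        indicator {exp (- s)<..<1} y =
      ennreal ?c * (ennreal (psi m (s + ln y)) * indicator {exp (- s)<..<exp (- 0)} y)"
    proof (cases "exp (- s) < y")
      case True
      have "emeasure P_unif (poisson_event m (s + ln y) \<inter> poisson_event k (t + ln y)) =
          ennreal (poisson_joint m k (s + ln y) (t + ln y))"
        using s_le_t add_ln_pos(2)[OF True] by (intro joint) auto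
      also have "\<dots> = ennreal ?c * ennreal (psi m (s + ln y))"
        unfolding factor(2) using factor(1) add_ln_pos(2)[OF True] by (intro ennreal_mult psi_nonneg) auto
      finally show ?thesis
        using add_ln_pos[OF True] by (simp add: case_nat_in_poisson_event_Suc mult.assoc)
    qed simp
  qed
  also have "\<dots> = ennreal ?c * ennreal (exp (- 0) * psi (Suc m) (s - 0))"
    using s_le_t by (subst nn_integral_cmult, measurable) (subst nn_integral_psi_ln, auto)
  also have "\<dots> = ennreal (poisson_joint (Suc m) (Suc k) s t)"
    using s_le_t factor(1) by (simp add: poisson_joint_def psi_nonneg mult.commute flip: ennreal_mult)
  finally show ?thesis .
qed

text \<open>Conditioning on the first arrival gives the independence of the increments.\<close>

lemma emeasure_poisson_event_joint:
  assumes "0 < s" "s \<le> t"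
  shows "emeasure P_unif (poisson_event i s \<inter> poisson_event j t) = ennreal (poisson_joint i j s t)"
  using assms
proof (induction j arbitrary: i s t)
  case 0
  then show ?case
    by (cases i) (simp_all add: emeasure_poisson_event_0_0 emeasure_poisson_event_Suc_0 poisson_joint_def)
next
  case (Suc k)
  show ?case
  proof (cases i)
    case 0
    have "emeasure P_unif (poisson_event k \<tau>) = ennreal (psi k \<tau>)" if "0 < \<tau>" for \<tau>
      using Suc.IH[OF that order_refl, of k] by (simp add: poisson_joint_same)
    then show ?thesis using 0 Suc.prems by (simp add: emeasure_poisson_event_0_Suc)
  next
    case (Suc m)
    then show ?thesis using Suc.prems Suc.IH by (simp add: emeasure_poisson_event_Suc_Suc)
  qed
qed

lemma prob_poisson_event_joint:
  assumes "0 < s" "s \<le> t"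
  shows "P_unif.prob (poisson_event i s \<inter> poisson_event j t) = poisson_joint i j s t"
  using emeasure_poisson_event_joint[OF assms] poisson_joint_nonneg[of s t] assms
  by (simp add: measure_def)

lemma prob_poisson_event:
  assumes "0 < t"
  shows "P_unif.prob (poisson_event k t) = psi k t"
  using prob_poisson_event_joint[OF assms order_refl, of k k] by (simp add: poisson_joint_same)

section \<open>Covariances of the counting events\<close>

lemma has_real_derivative_poisson_cdf:
  "((\<lambda>t. \<Sum>j\<le>k. psi j t) has_real_derivative - psi k t) (at t)"
proof (induction k)
  case 0
  show ?case unfolding psi_def by (auto intro!: derivative_eq_intros)
next
  case (Suc k)
  have "real (Suc k) / fact (Suc k) = 1 / fact k"
    by (simp add: field_simps del: of_nat_Suc)
  then have "real (Suc k) / fact (Suc k) * t ^ k * exp (- t) = psi k t"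
    by (simp only:) (simp add: psi_def)
  moreover have "(psi (Suc k) has_real_derivative
      real (Suc k) / fact (Suc k) * t ^ k * exp (- t) - psi (Suc k) t) (at t)"
    unfolding psi_def[abs_def]
    by (auto intro!: derivative_eq_intros simp: field_simps simp del: of_nat_Suc fact_Suc power_Suc)
  ultimately show ?case
    using DERIV_add[OF Suc] by fastforce
qed

lemma psi_tendsto_0_at_top: "(psi k \<longlongrightarrow> 0) at_top"
proof -
  have "((\<lambda>t::real. (t ^ k / exp t) / fact k) \<longlongrightarrow> 0 / fact k) at_top"
    by (rule tendsto_divide[OF tendsto_power_div_exp_0 tendsto_const]) simp
  then show ?thesis by (simp add: psi_def[abs_def] exp_minus field_simps)
qed

lemma isCont_psi: "isCont (psi k) t"
  unfolding psi_def[abs_def] by (intro continuous_intros) auto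

lemma has_real_derivative_poisson_cdf_exp:
  "((\<lambda>x. \<Sum>j\<le>k. psi j (c * exp (- x))) has_real_derivative real (Suc k) * psi (Suc k) (c * exp (- x))) (at x)"
proof -
  have "real (Suc k) * psi (Suc k) (c * exp (- x)) = c * exp (- x) * psi k (c * exp (- x))"
    by (simp add: psi_def field_simps del: of_nat_Suc)
  then show ?thesis
    by (simp only:)
      (rule DERIV_chain2[OF has_real_derivative_poisson_cdf, THEN DERIV_cong], auto intro!: derivative_eq_intros)
qed

lemma has_bochner_integral_psi_exp:
  assumes "0 < c"
  shows "has_bochner_integral lborel (\<lambda>x. psi (Suc k) (c * exp (- x))) (1 / real (Suc k))"
proof -
  define F where "F x = (\<Sum>j\<le>k. psi j (c * exp (- x)))" for x
  define f where "f x = real (Suc k) * psi (Suc k) (c * exp (- x))" for x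
  have deriv: "(F has_real_derivative f x) (at x)" for x
    unfolding F_def f_def by (rule has_real_derivative_poisson_cdf_exp)
  have cont: "isCont f x" and nonneg: "0 \<le> f x" for x
    using assms unfolding f_def psi_def by (auto intro!: continuous_intros)
  have bot: "(F \<longlongrightarrow> 0) at_bot"
  proof -
    have "filterlim (\<lambda>x. c * exp (- x)) at_top at_bot"
      using assms
      by (intro filterlim_tendsto_pos_mult_at_top[OF tendsto_const]
          filterlim_compose[OF exp_at_top filterlim_uminus_at_top_at_bot])
    then show ?thesis
      unfolding F_def by (intro tendsto_null_sum filterlim_compose[OF psi_tendsto_0_at_top])
  qed
  have top: "(F \<longlongrightarrow> 1) at_top"
  proof -
    have "((\<lambda>x. c * exp (- x)) \<longlongrightarrow> 0) at_top"
      using tendsto_mult[OF tendsto_const[of c] filterlim_compose[OF exp_at_bot filterlim_uminus_at_bot_at_top]]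
      by simp
    then have "(F \<longlongrightarrow> (\<Sum>j\<le>k. psi j 0)) at_top"
      unfolding F_def by (intro tendsto_sum isCont_tendsto_compose[OF isCont_psi])
    moreover have "(\<Sum>j\<le>k. psi j 0) = 1"
      by (induction k) (auto simp: psi_def)
    ultimately show ?thesis by simp
  qed
  have "set_integrable lborel (einterval (-\<infinity>) \<infinity>) f" "(LBINT x=-\<infinity>..\<infinity>. f x) = 1 - 0"
    by (rule interval_integral_FTC_nonneg[where F=F];
        use deriv cont nonneg bot top in \<open>simp add: ereal_tendsto_simps1\<close>)+
  then have "has_bochner_integral lborel f 1"
    by (simp add: has_bochner_integral_iff set_integrable_def interval_integral_eq_integral
        interval_lebesgue_integral_def set_lebesgue_integral_def)
  from has_bochner_integral_mult_right[OF this, of "1 / real (Suc k)"]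
  show ?thesis by (simp add: f_def)
qed

lemma has_bochner_integral_frullani:
  assumes "0 < c" "c \<le> d"
  shows "has_bochner_integral lborel (\<lambda>x. psi 0 (c * exp (- x)) - psi 0 (d * exp (- x))) (ln (d / c))"
proof (rule has_bochner_integral_nn_integral)
  let ?g = "\<lambda>x w. ennreal (exp (- x) * exp (- (w * exp (- x)))) * indicator {c..d} w"
  have inner: "ennreal (psi 0 (c * exp (- x)) - psi 0 (d * exp (- x))) = (\<integral>\<^sup>+w. ?g x w \<partial>lborel)" for x
  proof -
    have "(\<integral>\<^sup>+w. ?g x w \<partial>lborel) = ennreal (- exp (- (d * exp (- x))) - (- exp (- (c * exp (- x)))))"
      using assms by (intro nn_integral_FTC_Icc) (auto intro!: derivative_eq_intros)
    then show ?thesis by (simp add: psi_def)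
  qed
  have outer: "(\<integral>\<^sup>+x. ?g x w \<partial>lborel) = ennreal (1 / w) * indicator {c..d} w" for w
  proof (cases "w \<in> {c..d}")
    case True
    then have w_pos: "0 < w" using assms by simp
    have "has_bochner_integral lborel (\<lambda>x. 1 / w * psi (Suc 0) (w * exp (- x))) (1 / w * (1 / real (Suc 0)))"
      using w_pos by (intro has_bochner_integral_mult_right has_bochner_integral_psi_exp)
    then have "has_bochner_integral lborel (\<lambda>x. exp (- x) * exp (- (w * exp (- x)))) (1 / w)"
      using w_pos by (simp add: psi_def)
    then show ?thesis using True
      by (subst nn_integral_multc) (auto simp: nn_integral_eq_integral has_bochner_integral_iff)
  qed simp
  have "(\<integral>\<^sup>+x. ennreal (psi 0 (c * exp (- x)) - psi 0 (d * exp (- x))) \<partial>lborel) =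
      (\<integral>\<^sup>+w. \<integral>\<^sup>+x. ?g x w \<partial>lborel \<partial>lborel)"
    unfolding inner by (rule lborel_pair.Fubini') measurable
  also have "\<dots> = ennreal (ln d - ln c)"
    unfolding outer using assms by (intro nn_integral_FTC_Icc) (auto intro!: derivative_eq_intros)
  also have "ln d - ln c = ln (d / c)" using assms by (simp add: ln_div)
  finally show "(\<integral>\<^sup>+x. ennreal (psi 0 (c * exp (- x)) - psi 0 (d * exp (- x))) \<partial>lborel) = ennreal (ln (d / c))" .
qed (use assms in \<open>auto simp: psi_def\<close>)

text \<open>Splitting a Poisson variable of mean \<open>t\<close> into two independent ones of means \<open>p t\<close> and \<open>r t\<close>.\<close>

lemma psi_mult_psi:
  assumes "p + r = 1"
  shows "psi i (p * t) * psi m (r * t) = real ((i + m) choose i) * p ^ i * r ^ m * psi (i + m) t"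
proof -
  have "exp (- (p * t)) * exp (- (r * t)) = exp (- ((p + r) * t))"
    by (simp add: ring_distribs flip: exp_add)
  moreover have "real ((i + m) choose i) = fact (i + m) / (fact i * fact m)"
    using binomial_fact[of i "i + m", where 'a = real] by simp
  ultimately show ?thesis
    using assms by (simp add: psi_def power_mult_distrib power_add field_simps)
qed

definition gumbel_binomial :: "nat \<Rightarrow> nat \<Rightarrow> real \<Rightarrow> real \<Rightarrow> real" where
  "gumbel_binomial i m p r = 1 / real (i + m) * real ((i + m) choose i) * p ^ i * r ^ m"

lemma gumbel_binomial_commute: "gumbel_binomial i m p r = gumbel_binomial m i r p"
  using binomial_symmetric[of i "i + m"] by (simp add: gumbel_binomial_def add.commute mult_ac)

lemma has_bochner_integral_psi_mult_psi:
  assumes "0 < c" "p + r = 1" "i + m \<noteq> 0"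
  shows "has_bochner_integral lborel (\<lambda>x. psi i (p * (c * exp (- x))) * psi m (r * (c * exp (- x))))
    (gumbel_binomial i m p r)"
proof -
  obtain k where i_add_m: "i + m = Suc k" using assms(3) by (cases "i + m") auto
  have "has_bochner_integral lborel
      (\<lambda>x. real ((i + m) choose i) * p ^ i * r ^ m * psi (i + m) (c * exp (- x)))
      (real ((i + m) choose i) * p ^ i * r ^ m * (1 / real (i + m)))"
    unfolding i_add_m by (intro has_bochner_integral_mult_right has_bochner_integral_psi_exp assms)
  then show ?thesis
    unfolding psi_mult_psi[OF assms(2)] gumbel_binomial_def by (simp add: mult_ac)
qed

text \<open>Here \<open>q = exp (u - v)\<close> for \<open>u \<le> v\<close>.  For \<open>i = j = 0\<close> the weight \<open>1 / real (i + j)\<close> of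
  \<open>gumbel_binomial\<close> is a junk value.\<close>

definition X_cov :: "nat \<Rightarrow> nat \<Rightarrow> real \<Rightarrow> real" where
  "X_cov i j q = (if i = 0 \<and> j = 0 then ln (1 + q) else
     (if i \<le> j then gumbel_binomial i (j - i) q (1 - q) else 0)
     - gumbel_binomial i j (q / (1 + q)) (1 / (1 + q)))"

lemma has_bochner_integral_X_cov:
  assumes "0 < q" "0 < c"
  shows "has_bochner_integral lborel
    (\<lambda>x. poisson_joint i j (q * (c * exp (- x))) (c * exp (- x)) -
      psi i (q * (c * exp (- x))) * psi j (c * exp (- x)))
    (X_cov i j q)"
proof (cases "i = 0 \<and> j = 0")
  case True
  have "has_bochner_integral lborel (\<lambda>x. psi 0 (c * exp (- x)) - psi 0 ((1 + q) * c * exp (- x)))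
      (ln ((1 + q) * c / c))"
    using assms by (intro has_bochner_integral_frullani) auto
  moreover have "poisson_joint 0 0 (q * a) a - psi 0 (q * a) * psi 0 a = psi 0 a - psi 0 ((1 + q) * a)" for a
    by (simp add: poisson_joint_def psi_def algebra_simps flip: exp_add)
  ultimately show ?thesis
    using True assms by (simp add: X_cov_def mult.assoc)
next
  case False
  have "has_bochner_integral lborel (\<lambda>x. poisson_joint i j (q * (c * exp (- x))) (c * exp (- x)))
      (if i \<le> j then gumbel_binomial i (j - i) q (1 - q) else 0)"
  proof (cases "i \<le> j")
    case True
    then have "j \<noteq> 0" using False by auto
    moreover have "a - q * a = (1 - q) * a" for a by (simp add: algebra_simps)
    ultimately show ?thesis
      using has_bochner_integral_psi_mult_psi[OF assms(2), of q "1 - q" i "j - i"] True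
      by (simp add: poisson_joint_def)
  qed (simp add: poisson_joint_def has_bochner_integral_zero)
  moreover have "has_bochner_integral lborel (\<lambda>x. psi i (q * (c * exp (- x))) * psi j (c * exp (- x)))
      (gumbel_binomial i j (q / (1 + q)) (1 / (1 + q)))"
  proof -
    have "q / (1 + q) + 1 / (1 + q) = 1" "0 < (1 + q) * c"
      using assms by (simp_all add: field_simps add_pos_pos)
    then show ?thesis
      using has_bochner_integral_psi_mult_psi[of "(1 + q) * c" "q / (1 + q)" "1 / (1 + q)" i j] False assms
      by (simp add: mult.assoc)
  qed
  ultimately show ?thesis
    unfolding X_cov_def if_not_P[OF False] by (rule has_bochner_integral_diff)
qed

lemma (in prob_space) has_bochner_integral_centered_indicators:
  assumes [measurable]: "A \<in> events" "B \<in> events"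
  shows "has_bochner_integral M (\<lambda>\<omega>. (indicator A \<omega> - prob A) * (indicator B \<omega> - prob B))
    (prob (A \<inter> B) - prob A * prob B)"
proof -
  have indicator_integral: "has_bochner_integral M (indicat_real C) (prob C)" if "C \<in> events" for C
    using that by (intro has_bochner_integral_real_indicator) (auto simp: emeasure_eq_measure)
  have constant_integral: "has_bochner_integral M (\<lambda>_. c) c" for c :: real
    by (simp add: has_bochner_integral_iff prob_space)
  have "has_bochner_integral M
      (\<lambda>\<omega>. indicator (A \<inter> B) \<omega> - prob A * indicator B \<omega> - prob B * indicator A \<omega> + prob A * prob B)
      (prob (A \<inter> B) - prob A * prob B - prob B * prob A + prob A * prob B)"
    by (intro has_bochner_integral_add has_bochner_integral_diff has_bochner_integral_mult_right
        indicator_integral constant_integral) auto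
  moreover have "indicator (A \<inter> B) \<omega> - prob A * indicator B \<omega> - prob B * indicator A \<omega> + prob A * prob B =
      (indicator A \<omega> - prob A) * (indicator B \<omega> - prob B)" for \<omega>
    by (simp add: indicator_inter_arith algebra_simps)
  ultimately show ?thesis by (simp add: mult.commute)
qed

definition X_kernel :: "nat \<Rightarrow> real \<Rightarrow> real \<times> (nat \<Rightarrow> real) \<Rightarrow> real" where
  "X_kernel k u = (\<lambda>(x, y). indicator (poisson_event k (exp (- (x - u)))) y - psi k (exp (- (x - u))))"

lemma X_kernel_measurable [measurable]: "X_kernel k u \<in> borel_measurable intensity"
proof -
  note [measurable] = measurable_P_unif_component
  show ?thesis
    unfolding X_kernel_def intensity_def poisson_event_def indicator_def by measurable
qed

lemma has_bochner_integral_X_kernel_slice: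
  assumes "u \<le> v"
  shows "has_bochner_integral P_unif (\<lambda>y. X_kernel i u (x, y) * X_kernel j v (x, y))
    (poisson_joint i j (exp (- (x - u))) (exp (- (x - v))) - psi i (exp (- (x - u))) * psi j (exp (- (x - v))))"
  using P_unif.has_bochner_integral_centered_indicators[of
      "poisson_event i (exp (- (x - u)))" "poisson_event j (exp (- (x - v)))"] assms
  by (simp add: X_kernel_def prob_poisson_event prob_poisson_event_joint)

lemma has_bochner_integral_X_kernel_iterated:
  assumes "u \<le> v"
  shows "has_bochner_integral lborel (\<lambda>x. \<integral>y. X_kernel i u (x, y) * X_kernel j v (x, y) \<partial>P_unif)
    (X_cov i j (exp (u - v)))"
proof -
  have times: "exp (- (x - u)) = exp (u - v) * (exp v * exp (- x))" "exp (- (x - v)) = exp v * exp (- x)" for x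
    by (simp_all flip: exp_add)
  from has_bochner_integral_X_kernel_slice[OF assms, THEN has_bochner_integral_integral_eq]
  show ?thesis
    unfolding times by (simp only:) (rule has_bochner_integral_X_cov, simp_all)
qed

interpretation intensity: pair_sigma_finite lborel P_unif ..

lemma square_integrable_X_kernel: "square_integrable intensity (X_kernel k u)"
proof -
  have "integrable (lborel \<Otimes>\<^sub>M P_unif) (\<lambda>z. X_kernel k u z * X_kernel k u z)"
  proof (rule intensity.Fubini_integrable)
    show "(\<lambda>z. X_kernel k u z * X_kernel k u z) \<in> borel_measurable (lborel \<Otimes>\<^sub>M P_unif)"
      using X_kernel_measurable[of k u] unfolding intensity_def by measurable
    show "integrable lborel (\<lambda>x. \<integral>y. norm (X_kernel k u (x, y) * X_kernel k u (x, y)) \<partial>P_unif)"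
      using has_bochner_integral_X_kernel_iterated[of u u k k] by (simp add: has_bochner_integral_iff)
    show "AE x in lborel. integrable P_unif (\<lambda>y. X_kernel k u (x, y) * X_kernel k u (x, y))"
      using has_bochner_integral_X_kernel_slice[of u u k _ k] by (simp add: has_bochner_integral_iff)
  qed
  then show ?thesis
    by (simp add: square_integrable_def power2_eq_square flip: intensity_def)
qed

lemma integral_X_kernel_mult:
  "(\<integral>z. X_kernel i u z * X_kernel j v z \<partial>intensity) =
    (if u \<le> v then X_cov i j (exp (u - v)) else X_cov j i (exp (v - u)))"
proof -
  have ordered: "(\<integral>z. X_kernel i u z * X_kernel j v z \<partial>intensity) = X_cov i j (exp (u - v))"
    if "u \<le> v" for i j u v
  proof -
    have "(\<integral>z. X_kernel i u z * X_kernel j v z \<partial>intensity) =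
        (\<integral>x. (\<integral>y. X_kernel i u (x, y) * X_kernel j v (x, y) \<partial>P_unif) \<partial>lborel)"
      using square_integrable_mult[OF square_integrable_X_kernel square_integrable_X_kernel]
      unfolding intensity_def by (subst intensity.integral_fst') auto
    then show ?thesis
      using has_bochner_integral_X_kernel_iterated[OF that] by (simp add: has_bochner_integral_iff)
  qed
  show ?thesis
    using ordered[of u v i j] ordered[of v u j i] by (simp add: mult.commute)
qed

section \<open>Summation of the covariances\<close>

lemma binomial_half_sum:
  fixes p r :: real
  assumes "p + r = 1"
  shows "(\<Sum>k\<le>m. real ((m + k) choose k) * p ^ k) = (\<Sum>k\<le>m. real ((2 * m + 1) choose k) * p ^ k * r ^ (m - k))"
proof -
  have "real m + (real m + 1) gchoose k = real ((2 * m + 1) choose k)"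
    "real k + (real m + 1) - 1 gchoose k = real ((m + k) choose k)" for k
    by (simp_all add: binomial_gbinomial add_ac)
  then show ?thesis
    using gbinomial_partial_sum_poly_xpos[of m "real m + 1" p r] assms by simp
qed

text \<open>In Bernoulli trials with success probability \<open>p\<close>, either \<open>m + 1\<close> failures precede the
  \<open>(m + 1)\<close>-st success or the other way round.\<close>

lemma sum_bernoulli_race:
  fixes p r :: real
  assumes "p + r = 1"
  shows "(\<Sum>k\<le>m. real ((m + k) choose k) * (p ^ k * r ^ Suc m + r ^ k * p ^ Suc m)) = 1"
proof -
  let ?n = "2 * m + 1"
  let ?b = "\<lambda>k. real (?n choose k) * p ^ k * r ^ (?n - k)"
  have low: "(\<Sum>k\<le>m. real ((m + k) choose k) * (p ^ k * r ^ Suc m)) =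
      (\<Sum>k\<le>m. real (?n choose k) * p ^ k * r ^ (?n - k))" if "p + r = 1" for p r :: real
  proof -
    have "r ^ Suc m * (real (?n choose k) * p ^ k * r ^ (m - k)) = real (?n choose k) * p ^ k * r ^ (?n - k)"
      if "k \<le> m" for k
    proof -
      have "?n - k = Suc m + (m - k)" using that by simp
      then have "r ^ (?n - k) = r ^ Suc m * r ^ (m - k)" by (simp only: power_add)
      then show ?thesis by simp
    qed
    then have "r ^ Suc m * (\<Sum>k\<le>m. real (?n choose k) * p ^ k * r ^ (m - k)) =
        (\<Sum>k\<le>m. real (?n choose k) * p ^ k * r ^ (?n - k))"
      unfolding sum_distrib_left by (intro sum.cong) auto
    then show ?thesis
      unfolding binomial_half_sum[OF that, symmetric] by (simp add: sum_distrib_left mult_ac)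
  qed
  have "(\<Sum>k\<in>{Suc m..?n}. ?b k) = (\<Sum>k\<le>m. ?b (?n - k))"
    by (rule sum.reindex_bij_witness[of _ "\<lambda>k. ?n - k" "\<lambda>k. ?n - k"]) auto
  also have "\<dots> = (\<Sum>k\<le>m. real (?n choose k) * r ^ k * p ^ (?n - k))"
  proof (intro sum.cong refl)
    fix k assume "k \<in> {..m}"
    then show "?b (?n - k) = real (?n choose k) * r ^ k * p ^ (?n - k)"
      using binomial_symmetric[of k ?n] by simp
  qed
  finally have high: "(\<Sum>k\<in>{Suc m..?n}. ?b k) = (\<Sum>k\<le>m. real (?n choose k) * r ^ k * p ^ (?n - k))" .
  have "{..?n} = {..m} \<union> {Suc m..?n}" by auto
  then have "1 = (\<Sum>k\<le>m. ?b k) + (\<Sum>k\<in>{Suc m..?n}. ?b k)"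
    using binomial_ring[of p r ?n] assms by (simp add: sum.union_disjoint)
  then show ?thesis
    using low[of p r] low[of r p] high assms by (simp add: distrib_left sum.distrib add.commute)
qed

lemma sum_gumbel_binomial:
  assumes "1 \<le> l" and "p + r = 1"
  shows "(\<Sum>i\<le>l. gumbel_binomial i (l - i) p r) = 1 / real l"
proof -
  have "(\<Sum>i\<le>l. gumbel_binomial i (l - i) p r) = 1 / real l * (\<Sum>i\<le>l. real (l choose i) * p ^ i * r ^ (l - i))"
    by (simp add: gumbel_binomial_def sum_distrib_left mult.assoc)
  also have "(\<Sum>i\<le>l. real (l choose i) * p ^ i * r ^ (l - i)) = 1"
    using binomial_ring[of p r l] assms by simp
  finally show ?thesis by simp
qed

lemma sum_gumbel_binomial_border:
  assumes "1 \<le> l" and "p + r = 1"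
  shows "(\<Sum>i<l. gumbel_binomial i l p r + gumbel_binomial l i p r) = 1 / real l"
proof -
  obtain m where l_eq_Suc: "l = Suc m" using assms by (cases l) auto
  have summand: "gumbel_binomial i l p r + gumbel_binomial l i p r =
      1 / real l * (real ((m + i) choose i) * (p ^ i * r ^ Suc m + r ^ i * p ^ Suc m))" for i
  proof -
    have "l * ((i + l) choose i) = (i + l) * ((m + i) choose i)"
      using binomial_absorb_comp[of "i + l" i] by (simp add: l_eq_Suc add.commute)
    then have "real l * real ((i + l) choose i) = real (i + l) * real ((m + i) choose i)"
      by (simp only: flip: of_nat_mult)
    then have "1 / real (i + l) * real ((i + l) choose i) = 1 / real l * real ((m + i) choose i)"
      using assms by (simp add: field_simps)
    then show ?thesis
      unfolding gumbel_binomial_commute[of l] unfolding gumbel_binomial_def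
      by (simp add: l_eq_Suc algebra_simps)
  qed
  show ?thesis
    unfolding summand sum_distrib_left[symmetric]
    by (simp only: l_eq_Suc lessThan_Suc_atMost sum_bernoulli_race[OF assms(2)] mult_1_right)
qed

lemma X_cov_border:
  assumes "1 \<le> l" "0 < q"
  shows "X_cov l l q + (\<Sum>i<l. X_cov i l q + X_cov l i q) =
    - (fact (2 * l - 1) * q ^ l / ((fact l)\<^sup>2 * (1 + q) ^ (2 * l)))"
proof -
  define p r where "p = q / (1 + q)" and "r = 1 / (1 + q)"
  have p_add_r: "p + r = 1" using assms by (simp add: p_def r_def field_simps)
  have "X_cov l l q + (\<Sum>i<l. X_cov i l q + X_cov l i q) =
      (gumbel_binomial l 0 q (1 - q) + (\<Sum>i<l. gumbel_binomial i (l - i) q (1 - q))) -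
      (\<Sum>i<l. gumbel_binomial i l p r + gumbel_binomial l i p r) - gumbel_binomial l l p r"
    using assms by (simp add: X_cov_def p_def[symmetric] r_def[symmetric] sum.distrib sum_subtractf)
  also have "gumbel_binomial l 0 q (1 - q) + (\<Sum>i<l. gumbel_binomial i (l - i) q (1 - q)) =
      (\<Sum>i\<le>l. gumbel_binomial i (l - i) q (1 - q))"
    by (simp add: lessThan_Suc_atMost[symmetric])
  also have "\<dots> = 1 / real l"
    using assms by (intro sum_gumbel_binomial) auto
  also have "gumbel_binomial l l p r = fact (2 * l - 1) * q ^ l / ((fact l)\<^sup>2 * (1 + q) ^ (2 * l))"
  proof -
    have "real ((l + l) choose l) = fact (2 * l) / (fact l)\<^sup>2"
      using binomial_fact[of l "l + l", where 'a = real] by (simp add: power2_eq_square mult_2)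
    also have "fact (2 * l) = real (2 * l) * fact (2 * l - 1)"
      using assms by (intro fact_reduce) simp
    finally have "1 / real (l + l) * real ((l + l) choose l) = fact (2 * l - 1) / (fact l)\<^sup>2"
      using assms by simp
    moreover have "p ^ l * r ^ l = q ^ l / (1 + q) ^ (2 * l)"
      by (simp add: p_def r_def power_divide mult_2 power_add)
    ultimately show ?thesis
      unfolding gumbel_binomial_def mult.assoc[of _ "p ^ l"] by simp
  qed
  finally show ?thesis
    using sum_gumbel_binomial_border[OF assms(1) p_add_r] by simp
qed

lemma sum_X_cov:
  assumes "1 \<le> l"
  shows "(\<Sum>i<l. \<Sum>j<l. X_cov i j (exp (- \<bar>t\<bar>))) = cov_Z l t"
  using assms
proof (induction l rule: nat_induct_at_least)
  case base
  show ?case by (simp add: X_cov_def cov_Z_def)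
next
  case (Suc l)
  let ?q = "exp (- \<bar>t\<bar>)"
  have "(\<Sum>i<Suc l. \<Sum>j<Suc l. X_cov i j ?q) =
      (\<Sum>i<l. \<Sum>j<l. X_cov i j ?q) + (X_cov l l ?q + (\<Sum>i<l. X_cov i l ?q + X_cov l i ?q))"
    by (simp add: sum.distrib)
  then show ?case
    using Suc X_cov_border[OF Suc.hyps, of ?q]
    by (simp add: cov_Z_def exp_of_nat2_mult[symmetric] mult.commute)
qed

text \<open>The subtracted terms of \<open>cov_Z\<close> are powers of \<open>q / (1 + q)\<^sup>2\<close>, which is largest at \<open>q = 1\<close>.\<close>

lemma cov_Z_0_diff_le: "cov_Z l 0 - cov_Z l t \<le> \<bar>t\<bar>"
proof -
  define q where "q = exp (- \<bar>t\<bar>)"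
  have q_bounds: "0 < q" "q \<le> 1" by (simp_all add: q_def)
  have "q / (1 + q)\<^sup>2 \<le> 1 / 2\<^sup>2"
  proof -
    have "0 \<le> (1 - q)\<^sup>2" by simp
    then show ?thesis using q_bounds by (simp add: field_simps power2_eq_square)
  qed
  then have power_le: "(q / (1 + q)\<^sup>2) ^ k \<le> (1 / 2\<^sup>2) ^ k" for k
    using q_bounds by (intro power_mono) auto
  have summand: "fact (2 * k - 1) * exp (- \<bar>t\<bar> * real k) / ((fact k)\<^sup>2 * (1 + exp (- \<bar>t\<bar>)) ^ (2 * k)) \<le>
      fact (2 * k - 1) / ((fact k)\<^sup>2 * 2 ^ (2 * k))" for k
  proof -
    have "exp (- \<bar>t\<bar> * real k) = q ^ k" unfolding q_def by (rule exp_of_nat2_mult)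
    then show ?thesis
      using mult_left_mono[OF power_le[of k], of "fact (2 * k - 1) / (fact k)\<^sup>2"]
      by (simp add: q_def[symmetric] power_divide power_mult)
  qed
  have "ln (2 * q) \<le> ln (1 + q)" using q_bounds by simp
  then have "ln 2 - ln (1 + q) \<le> \<bar>t\<bar>" using q_bounds by (simp add: ln_mult q_def)
  moreover have "(\<Sum>k\<in>{1..<l}. fact (2 * k - 1) * exp (- \<bar>t\<bar> * real k) / ((fact k)\<^sup>2 * (1 + exp (- \<bar>t\<bar>)) ^ (2 * k))) \<le>
      (\<Sum>k\<in>{1..<l}. fact (2 * k - 1) / ((fact k)\<^sup>2 * 2 ^ (2 * k)))"
    by (intro sum_mono summand)
  ultimately show ?thesis by (simp add: cov_Z_def q_def)
qed

section \<open>The processes \<open>Z\<^sub>l\<close>\<close>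

definition Z1_kernel :: "real \<Rightarrow> real \<times> (nat \<Rightarrow> real) \<Rightarrow> real" where
  "Z1_kernel u = (\<lambda>(x, y). (if y 0 \<le> exp (- exp (- (x - u))) then 1 else 0) - exp (- exp (- (x - u))))"

lemma Z1_kernel_measurable [measurable]: "Z1_kernel u \<in> borel_measurable intensity"
proof -
  note [measurable] = measurable_P_unif_component
  show ?thesis unfolding Z1_kernel_def intensity_def by measurable
qed

lemma AE_Z1_kernel: "AE z in intensity. X_kernel 0 u z = Z1_kernel u z"
  unfolding intensity_def
proof (rule intensity.AE_pair_measure)
  show "{z \<in> space (lborel \<Otimes>\<^sub>M P_unif). X_kernel 0 u z = Z1_kernel u z} \<in> sets (lborel \<Otimes>\<^sub>M P_unif)"
    using Z1_kernel_measurable[of u] X_kernel_measurable[of 0 u]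
    unfolding intensity_def by measurable
  show "AE x in lborel. AE y in P_unif. X_kernel 0 u (x, y) = Z1_kernel u (x, y)"
  proof (rule AE_I2)
    fix x :: real
    have "AE y in unif01. y \<noteq> exp (- exp (- (x - u)))"
      by (intro AE_uniform_measureI eventually_mono[OF AE_lborel_singleton]) auto
    then have "AE y in P_unif. y 0 \<noteq> exp (- exp (- (x - u)))"
      unfolding P_unif_def by (intro AE_PiM_component prob_space_unif01) auto
    then show "AE y in P_unif. X_kernel 0 u (x, y) = Z1_kernel u (x, y)"
      by eventually_elim (auto simp: Z1_kernel_def X_kernel_def poisson_event_def psi_def indicator_def)
  qed
qed

lemma square_integrable_Z1_kernel: "square_integrable intensity (Z1_kernel u)"
  using square_integrable_X_kernel AE_Z1_kernel Z1_kernel_measurable by (rule square_integrable_cong_AE)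

definition Z_kernel :: "nat \<Rightarrow> real \<Rightarrow> real \<times> (nat \<Rightarrow> real) \<Rightarrow> real" where
  "Z_kernel l u z = (\<Sum>k<l. - 1 * X_kernel k u z)"

lemma square_integrable_Z_kernel: "square_integrable intensity (Z_kernel l u)"
  unfolding Z_kernel_def[abs_def] by (intro square_integrable_sum square_integrable_X_kernel)

lemma integral_Z_kernel_mult:
  "(\<integral>z. Z_kernel l u z * Z_kernel l' v z \<partial>intensity) =
    (\<Sum>i<l. \<Sum>j<l'. \<integral>z. X_kernel i u z * X_kernel j v z \<partial>intensity)"
  unfolding Z_kernel_def
  by (subst integral_sum_mult_sum) (auto intro: square_integrable_X_kernel)

lemma integral_Z_kernel_eq_cov_Z:
  assumes "1 \<le> l"
  shows "(\<integral>z. Z_kernel l u z * Z_kernel l v z \<partial>intensity) = cov_Z l (u - v)"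
proof -
  have "(\<Sum>i<l. \<Sum>j<l. X_cov j i (exp (- \<bar>u - v\<bar>))) = (\<Sum>i<l. \<Sum>j<l. X_cov i j (exp (- \<bar>u - v\<bar>)))"
    by (rule sum.swap)
  then show ?thesis
    using sum_X_cov[OF assms, of "u - v"]
    by (cases "u \<le> v") (simp_all add: integral_Z_kernel_mult integral_X_kernel_mult)
qed

lemma integral_X_kernel_mult_less:
  assumes "i < j"
  shows "(\<integral>z. X_kernel i u z * X_kernel j v z \<partial>intensity) =
    1 / real j * real (j choose i) * (max 0 (1 - exp (u - v))) ^ (j - i) * exp ((u - v) * i)
      - 1 / real (j + i) * real ((j + i) choose i) * exp ((u - v) * i) / (1 + exp (u - v)) ^ (j + i)"
proof -
  define q where "q = exp (u - v)"
  have q_props: "0 < q" "exp (v - u) = 1 / q" by (simp_all add: q_def exp_diff)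
  have "(\<integral>z. X_kernel i u z * X_kernel j v z \<partial>intensity) =
      gumbel_binomial i (j - i) q (max 0 (1 - q)) - gumbel_binomial i j (q / (1 + q)) (1 / (1 + q))"
  proof (cases "u \<le> v")
    case True
    then have "max 0 (1 - q) = 1 - q" by (simp add: q_def)
    with True show ?thesis
      using assms by (simp add: integral_X_kernel_mult X_cov_def flip: q_def)
  next
    case False
    have "1 / q / (1 + 1 / q) = 1 / (1 + q)" "1 / (1 + 1 / q) = q / (1 + q)"
      using q_props by (simp_all add: field_simps)
    moreover have "gumbel_binomial i (j - i) q (max 0 (1 - q)) = 0"
      using False assms by (simp add: q_def gumbel_binomial_def)
    ultimately show ?thesis
      using False assms q_props
      by (simp add: integral_X_kernel_mult X_cov_def gumbel_binomial_commute[of j])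
  qed
  also have "gumbel_binomial i (j - i) q (max 0 (1 - q)) =
      1 / real j * real (j choose i) * (max 0 (1 - q)) ^ (j - i) * q ^ i"
    using assms by (simp add: gumbel_binomial_def mult_ac)
  also have "gumbel_binomial i j (q / (1 + q)) (1 / (1 + q)) =
      1 / real (j + i) * real ((j + i) choose i) * q ^ i / (1 + q) ^ (j + i)"
    by (simp add: gumbel_binomial_def power_divide power_add add.commute mult_ac)
  finally show ?thesis
    by (simp add: q_def exp_of_nat2_mult)
qed

lemma integral_Z_kernel_eq_cross_cov_Z:
  assumes "1 \<le> l"
  shows "(\<integral>z. Z_kernel l u z * Z_kernel (l + n) v z \<partial>intensity) = cross_cov_Z l n u v"
proof -
  let ?c = "\<lambda>i j. \<integral>z. X_kernel i u z * X_kernel j v z \<partial>intensity"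
  have "(\<Sum>j<l+n. a j) = (\<Sum>j<l. a j) + (\<Sum>r<n. a (l + r))" for a :: "nat \<Rightarrow> real"
    by (induction n) auto
  then have "(\<integral>z. Z_kernel l u z * Z_kernel (l + n) v z \<partial>intensity) =
      (\<Sum>i<l. \<Sum>j<l. ?c i j) + (\<Sum>i<l. \<Sum>r<n. ?c i (l + r))"
    by (simp add: integral_Z_kernel_mult sum.distrib)
  also have "(\<Sum>i<l. \<Sum>j<l. ?c i j) = cov_Z l (u - v)"
    using integral_Z_kernel_eq_cov_Z[OF assms, of u v] by (simp add: integral_Z_kernel_mult)
  also have "(\<Sum>i<l. \<Sum>r<n. ?c i (l + r)) = (\<Sum>r<n. \<Sum>i<l. ?c i (l + r))"
    by (rule sum.swap)
  finally show ?thesis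
    by (simp add: cross_cov_Z_def integral_X_kernel_mult_less)
qed

locale intensity_wiener = wiener M intensity W I
  for M :: "'w measure" and W :: "(real \<times> (nat \<Rightarrow> real)) set \<Rightarrow> 'w \<Rightarrow> real"
    and I :: "(real \<times> (nat \<Rightarrow> real) \<Rightarrow> real) \<Rightarrow> 'w \<Rightarrow> real"
begin

lemma Xk_eq: "Xk I k u = I (X_kernel k u)"
  unfolding Xk_def
  by (intro arg_cong[where f=I] ext) (auto simp: X_kernel_def poisson_event_def psi_def[of 0])

lemma Zl_eq: "Zl I l u \<omega> = - I (Z1_kernel u) \<omega> - (\<Sum>k\<in>{1..<l}. I (X_kernel k u) \<omega>)"
  by (simp add: Zl_def Xk_eq Z1_def Z1_kernel_def)

lemma Zl_measurable: "random_variable borel (Zl I l u)"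
  unfolding Zl_eq[abs_def]
  using I_measurable[OF square_integrable_Z1_kernel] I_measurable[OF square_integrable_X_kernel]
  by measurable

lemma AE_Zl:
  assumes "1 \<le> l"
  shows "AE \<omega> in M. I (Z_kernel l u) \<omega> = Zl I l u \<omega>"
proof -
  have "AE \<omega> in M. I (X_kernel 0 u) \<omega> = I (Z1_kernel u) \<omega>"
    by (intro I_cong_AE square_integrable_Z1_kernel square_integrable_X_kernel AE_Z1_kernel)
  moreover have "AE \<omega> in M. I (Z_kernel l u) \<omega> = (\<Sum>k<l. - 1 * I (X_kernel k u) \<omega>)"
    unfolding Z_kernel_def[abs_def] by (intro I_sum square_integrable_X_kernel) simp
  ultimately show ?thesis
  proof eventually_elim
    case (elim \<omega>)
    have "{..<l} = insert 0 {1..<l}" using assms by auto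
    then show ?case using elim by (simp add: Zl_eq sum_negf)
  qed
qed

lemma Zl_gaussian:
  assumes "1 \<le> l"
  shows "centered_gaussian_family M UNIV (Zl I l)"
proof (rule centered_gaussian_family_cong_AE)
  show "centered_gaussian_family M UNIV (\<lambda>u. I (Z_kernel l u))"
    by (intro I_centered_gaussian_family square_integrable_Z_kernel)
qed (use assms in \<open>auto intro: AE_Zl Zl_measurable\<close>)

lemma Zl_product:
  assumes "1 \<le> l" "1 \<le> l'"
  shows "(\<integral>\<omega>. Zl I l u \<omega> * Zl I l' v \<omega> \<partial>M) = (\<integral>z. Z_kernel l u z * Z_kernel l' v z \<partial>intensity)"
proof -
  note [measurable] = I_measurable[OF square_integrable_Z_kernel] Zl_measurable
  have "AE \<omega> in M. Zl I l u \<omega> * Zl I l' v \<omega> = I (Z_kernel l u) \<omega> * I (Z_kernel l' v) \<omega>"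
    using AE_Zl[OF assms(1), of u] AE_Zl[OF assms(2), of v] by eventually_elim simp
  then have "(\<integral>\<omega>. Zl I l u \<omega> * Zl I l' v \<omega> \<partial>M) = (\<integral>\<omega>. I (Z_kernel l u) \<omega> * I (Z_kernel l' v) \<omega> \<partial>M)"
    by (intro integral_cong_AE) auto
  then show ?thesis
    by (simp add: I_product square_integrable_Z_kernel)
qed

lemma Zl_covariance:
  assumes "1 \<le> l"
  shows "expectation (\<lambda>\<omega>. Zl I l u \<omega> * Zl I l v \<omega>) = cov_Z l (u - v)"
  using assms by (simp add: Zl_product integral_Z_kernel_eq_cov_Z)

lemma Zl_increment_variance:
  assumes "1 \<le> l"
  shows "expectation (\<lambda>\<omega>. (Zl I l u \<omega> - Zl I l v \<omega>)\<^sup>2) \<le> 2 * \<bar>u - v\<bar>"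
proof -
  have "square_integrable M (Zl I l u)" for u
    using Zl_gaussian[OF assms] by (rule centered_gaussian_family_square_integrable) simp
  then have "expectation (\<lambda>\<omega>. (Zl I l u \<omega> - Zl I l v \<omega>)\<^sup>2) = 2 * (cov_Z l 0 - cov_Z l (u - v))"
    by (simp add: integral_diff_square Zl_covariance[OF assms])
  then show ?thesis using cov_Z_0_diff_le[of l "u - v"] by simp
qed

end

theorem theorem1p8:
  fixes M :: "'w measure"
    and W :: "(real \<times> (nat \<Rightarrow> real)) set \<Rightarrow> 'w \<Rightarrow> real"
    and I :: "((real \<times> (nat \<Rightarrow> real)) \<Rightarrow> real) \<Rightarrow> 'w \<Rightarrow> real"
  assumes "prob_space M"
    and "gaussian_white_noise M intensity W"
    and "wiener_integral M intensity W I"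
  shows "\<forall>l\<ge>1.
      centered_gaussian_family M UNIV (Zl I l) \<and>
      stationary_process M (Zl I l) \<and>
      (\<forall>u v. integral\<^sup>L M (\<lambda>\<omega>. Zl I l u \<omega> * Zl I l v \<omega>) = cov_Z l (u - v)) \<and>
      (\<forall>n u v. integral\<^sup>L M (\<lambda>\<omega>. Zl I l u \<omega> * Zl I (l + n) v \<omega>) = cross_cov_Z l n u v) \<and>
      (\<exists>Z'. (\<forall>u. Z' u \<in> borel_measurable M \<and> (AE \<omega> in M. Z' u \<omega> = Zl I l u \<omega>)) \<and>
            (\<forall>\<omega>\<in>space M. \<forall>\<alpha>. 0 < \<alpha> \<and> \<alpha> < 1/2 \<longrightarrow> locally_holder (\<lambda>u. Z' u \<omega>) \<alpha>))"
proof -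
  interpret prob_space M by fact
  interpret intensity_wiener M W I by unfold_locales fact+
  show ?thesis
  proof (intro allI impI conjI)
    fix l :: nat assume l_pos: "1 \<le> l"
    show gaussian: "centered_gaussian_family M UNIV (Zl I l)"
      using l_pos by (rule Zl_gaussian)
    show covariance: "integral\<^sup>L M (\<lambda>\<omega>. Zl I l u \<omega> * Zl I l v \<omega>) = cov_Z l (u - v)" for u v
      using l_pos by (rule Zl_covariance)
    show "stationary_process M (Zl I l)"
      using gaussian by (rule stationary_process_if_shift_invariant_covariance) (simp add: covariance)
    show "integral\<^sup>L M (\<lambda>\<omega>. Zl I l u \<omega> * Zl I (l + n) v \<omega>) = cross_cov_Z l n u v" for n u v
      using l_pos by (simp add: Zl_product integral_Z_kernel_eq_cross_cov_Z)
    show "\<exists>Z'. (\<forall>u. Z' u \<in> borel_measurable M \<and> (AE \<omega> in M. Z' u \<omega> = Zl I l u \<omega>)) \<and>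
            (\<forall>\<omega>\<in>space M. \<forall>\<alpha>. 0 < \<alpha> \<and> \<alpha> < 1/2 \<longrightarrow> locally_holder (\<lambda>u. Z' u \<omega>) \<alpha>)"
      using gaussian by (rule gaussian_holder_version) (use Zl_increment_variance[OF l_pos] in auto)
  qed
qed

end
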